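(* Let $p$ be a prime and let $n,m$ be positive integers. Then $$\exp_{\bullet}(K(p^n,p^m))=p^{n+m}.$$ In particular, $\exp_{\bullet}(P)=4$ for the Promislow group $P$, and $\exp_{\bullet}(K(p))=p^2$.
   Context: Notation: $x^y=y^{-1}xy$ and $[x,y]=x^{-1}y^{-1}xy$. For a conjugacy class $C$ of a group $G$ and $k\ge1$, put $C^k=\{c_1\cdots c_k\mid c_i\in C\}$. The generalized exponent $\exp_{\bullet}(G)$ is the smallest positive integer $k$ such that $1\in C^k$ for all conjugacy classes $C$ of $G$ (if such a $k$ exists). For a polynomial $f(T)=n_0+n_1T+\dots+n_kT^k$ with integer coefficients and group elements $g,h$, write $g^{f(h)}=(g^{n_0})(g^{n_1})^h\cdots(g^{n_k})^{h^k}$. Let $\Psi_k(T)=1+T+\dots+T^{k-1}$. For a prime $p$ and positive integers $n,m$, the group $K(p^n,p^m)$ is defined by the presentation in the variety of metabelian groups $$K(p^n,p^m)=\langle x,y\mid [[x,y],x^{p^n}],\ [[x,y],y^{p^m}],\ (x^{p^n})^{\Psi_{p^m}(y)},\ (y^{p^m})^{\Psi_{p^n}(x)}\rangle_{\text{metab}},$$ that is, it is the quotient of the free metabelian group on $x,y$ by the normal closure of the listed relators. Put $K(p)=K(p^1,p^1)$. The Promislow group is $P=\langle x,y\mid x^{-1}y^2x=y^{-2},\ y^{-1}x^2y=x^{-2}\rangle$, which is isomorphic to $K(2)$. *)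

theory Defs
  imports "HOL-Algebra.Generated_Groups" "HOL-Computational_Algebra.Polynomial"
    "HOL-Computational_Algebra.Primes"
begin

section \<open>Free groups as reduced words\<close>

text \<open>A letter (a, True) stands for the generator a, and (a, False) for its inverse.\<close>

definition inv_letter :: "'a \<times> bool \<Rightarrow> 'a \<times> bool" where
  "inv_letter l = (fst l, \<not> snd l)"

fun reduced :: "('a \<times> bool) list \<Rightarrow> bool" where
  "reduced (k # l # w) \<longleftrightarrow> l \<noteq> inv_letter k \<and> reduced (l # w)"
| "reduced _ \<longleftrightarrow> True"

text \<open>Left multiplication of a reduced word by one letter, cancelling if possible.\<close>

definition push_letter :: "'a \<times> bool \<Rightarrow> ('a \<times> bool) list \<Rightarrow> ('a \<times> bool) list" where
  "push_letter l w = (if w \<noteq> [] \<and> hd w = inv_letter l then tl w else l # w)"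

definition free_group :: "('a \<times> bool) list monoid" where
  "free_group = \<lparr>carrier = {w. reduced w}, monoid.mult = (\<lambda>u v. foldr push_letter u v), one = []\<rparr>"

definition free_gen :: "'a \<Rightarrow> ('a \<times> bool) list" where
  "free_gen a = [(a, True)]"

lemma inv_letter_inv_letter [simp]: "inv_letter (inv_letter l) = l"
  by (simp add: inv_letter_def)

lemma inv_letter_neq [simp]: "inv_letter l \<noteq> l" "l \<noteq> inv_letter l"
  by (auto simp: inv_letter_def prod_eq_iff)

lemma reduced_tl: "reduced (l # w) \<Longrightarrow> reduced w"
  by (cases w) auto

lemma reduced_push_letter: "reduced w \<Longrightarrow> reduced (push_letter l w)"
  by (cases w) (auto simp: push_letter_def reduced_tl)

lemma push_letter_cancel:
  assumes "reduced w"
  shows "push_letter l (push_letter (inv_letter l) w) = w"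
proof (cases w)
  case Nil
  then show ?thesis by (simp add: push_letter_def)
next
  case (Cons k v)
  show ?thesis
  proof (cases "k = l")
    case True
    then show ?thesis using assms Cons by (cases v) (auto simp: push_letter_def)
  next
    case False
    then show ?thesis using Cons by (auto simp: push_letter_def)
  qed
qed

lemma reduced_foldr_push: "reduced v \<Longrightarrow> reduced (foldr push_letter u v)"
  by (induction u) (auto simp: reduced_push_letter)

lemma foldr_push_letter_push:
  assumes "reduced w"
  shows "foldr push_letter (push_letter l u) w = push_letter l (foldr push_letter u w)"
proof (cases "u \<noteq> [] \<and> hd u = inv_letter l")
  case True
  then obtain v where "u = inv_letter l # v" by (cases u) auto
  then show ?thesis
    using push_letter_cancel[OF reduced_foldr_push[OF assms]] by (simp add: push_letter_def)
next
  case False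
  then show ?thesis by (auto simp: push_letter_def)
qed

lemma foldr_push_assoc:
  assumes "reduced w"
  shows "foldr push_letter (foldr push_letter u v) w = foldr push_letter u (foldr push_letter v w)"
  by (induction u) (simp_all add: foldr_push_letter_push assms)

lemma foldr_push_reduced: "reduced w \<Longrightarrow> foldr push_letter w [] = w"
proof (induction w)
  case (Cons l w)
  then show ?case by (cases w) (auto simp: push_letter_def)
qed simp

lemma group_free_group: "group (free_group :: ('a \<times> bool) list monoid)"
proof (rule groupI)
  fix w :: "('a \<times> bool) list"
  assume "w \<in> carrier free_group"
  have red: "reduced (foldr push_letter (rev (map inv_letter w)) [])"
    by (simp add: reduced_foldr_push)
  have "foldr push_letter (rev (map inv_letter w)) (foldr push_letter w v) = v"
    if "reduced v" for v
    using that
  proof (induction w arbitrary: v)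
    case (Cons l w)
    have "push_letter (inv_letter l) (push_letter (inv_letter (inv_letter l))
            (foldr push_letter w v)) = foldr push_letter w v"
      by (rule push_letter_cancel) (simp add: reduced_foldr_push Cons.prems)
    then show ?case using Cons by simp
  qed simp
  from this[of "[]"] show "\<exists>v\<in>carrier free_group. v \<otimes>\<^bsub>free_group\<^esub> w = \<one>\<^bsub>free_group\<^esub>"
    using red \<open>w \<in> carrier free_group\<close>
      foldr_push_assoc[of w "rev (map inv_letter w)" "[]"]
    by (intro bexI[of _ "foldr push_letter (rev (map inv_letter w)) []"])
      (auto simp: free_group_def foldr_push_reduced)
qed (auto simp: free_group_def reduced_foldr_push foldr_push_assoc)

text \<open>The universal property: free_group is free on the family free_gen.\<close>

lemma free_gen_in_carrier: "free_gen a \<in> carrier free_group"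
  by (simp add: free_gen_def free_group_def)

lemma inv_free_gen: "inv\<^bsub>free_group\<^esub> (free_gen a) = [(a, False)]"
  by (rule group.inv_equality[OF group_free_group])
    (simp_all add: free_gen_def free_group_def push_letter_def inv_letter_def)

lemma free_group_generated:
  "generate free_group (range (free_gen :: 'a \<Rightarrow> _)) = carrier free_group"
proof
  interpret F: group free_group by (rule group_free_group)
  show "generate free_group (range (free_gen :: 'a \<Rightarrow> _)) \<subseteq> carrier free_group"
    by (rule F.generate_incl) (auto simp: free_gen_in_carrier)
  have "w \<in> generate free_group (range free_gen)" if "reduced w" for w :: "('a \<times> bool) list"
    using that
  proof (induction w)
    case Nil
    then show ?case using generate.one[of free_group] by (simp add: free_group_def)
  next
    case (Cons l w)
    obtain a b where l: "l = (a, b)" by (cases l)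
    have "[l] \<in> generate free_group (range free_gen)"
      using generate.incl[of "free_gen a" "range free_gen" free_group]
        generate.inv[of "free_gen a" "range free_gen" free_group]
      by (cases b) (auto simp: l inv_free_gen, simp add: free_gen_def)
    moreover have "[l] \<otimes>\<^bsub>free_group\<^esub> w = l # w"
      using Cons.prems by (cases w) (auto simp: free_group_def push_letter_def)
    ultimately show ?case
      using Cons generate.eng reduced_tl by metis
  qed
  moreover have "reduced w" if "w \<in> carrier free_group" for w :: "('a \<times> bool) list"
    using that by (simp add: free_group_def)
  ultimately show "carrier free_group \<subseteq> generate free_group (range (free_gen :: 'a \<Rightarrow> _))"
    by blast
qed

lemma free_group_universal:
  fixes f :: "'a \<Rightarrow> 'c"
  assumes "group G" and f: "\<And>a. f a \<in> carrier G"
  shows "\<exists>h \<in> hom free_group G. \<forall>a. h (free_gen a) = f a"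
proof -
  interpret G: group G by fact
  define e where "e = (\<lambda>l :: 'a \<times> bool. if snd l then f (fst l) else inv\<^bsub>G\<^esub> f (fst l))"
  define h where "h w = foldr (\<lambda>l z. e l \<otimes>\<^bsub>G\<^esub> z) w \<one>\<^bsub>G\<^esub>" for w
  have e: "e l \<in> carrier G" for l by (simp add: e_def f)
  have e_inv: "e (inv_letter l) = inv\<^bsub>G\<^esub> e l" for l by (simp add: e_def inv_letter_def f)
  have h: "h w \<in> carrier G" for w by (induction w) (simp_all add: h_def e)
  have h_Cons: "h (l # w) = e l \<otimes>\<^bsub>G\<^esub> h w" for l w by (simp add: h_def)
  have push: "h (push_letter l w) = e l \<otimes>\<^bsub>G\<^esub> h w" for l w
  proof (cases "w \<noteq> [] \<and> hd w = inv_letter l")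
    case True
    then obtain v where "w = inv_letter l # v" by (cases w) auto
    then show ?thesis
      by (simp add: push_letter_def h_Cons e_inv e h G.m_assoc[symmetric])
  next
    case False
    then show ?thesis by (auto simp: push_letter_def h_Cons)
  qed
  have "h (foldr push_letter u v) = h u \<otimes>\<^bsub>G\<^esub> h v" for u v
  proof (induction u)
    case Nil
    then show ?case using h[of v] by (simp add: h_def[of "[]"])
  next
    case (Cons l u)
    then show ?case by (simp add: push h_Cons e h G.m_assoc)
  qed
  then have "h \<in> hom free_group G" by (auto simp: hom_def free_group_def h)
  moreover have "h (free_gen a) = f a" for a by (simp add: h_def free_gen_def e_def f)
  ultimately show ?thesis by blast
qed

section \<open>Normal closures, presentations\<close>

definition normal_closure :: "('a, 'b) monoid_scheme \<Rightarrow> 'a set \<Rightarrow> 'a set" where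
  "normal_closure G R = \<Inter>{N. N \<lhd> G \<and> R \<subseteq> N}"

lemma (in group) normal_normal_closure:
  assumes "R \<subseteq> carrier G"
  shows "normal_closure G R \<lhd> G"
proof -
  have G: "carrier G \<lhd> G" by (rule normal_invI) (auto simp: subgroup_self)
  have "subgroup (normal_closure G R) G"
    unfolding normal_closure_def
    by (rule subgroups_Inter) (use G assms in \<open>auto dest: normal_imp_subgroup\<close>)
  then show ?thesis
    by (rule normal_invI) (auto simp: normal_closure_def normal_inv_iff)
qed

definition free_metabelian :: "('a \<times> bool) list set monoid" where
  "free_metabelian = free_group Mod derived free_group (derived free_group (carrier free_group))"

definition free_metabelian_gen :: "'a \<Rightarrow> ('a \<times> bool) list set" where
  "free_metabelian_gen a =
     derived free_group (derived free_group (carrier free_group)) #>\<^bsub>free_group\<^esub> free_gen a"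

lemma group_free_metabelian: "group free_metabelian"
proof -
  interpret F: group free_group by (rule group_free_group)
  have "derived free_group (carrier free_group) \<lhd> free_group"
    by (rule F.derived_is_normal) (rule F.normal_invI, auto simp: F.subgroup_self)
  then have "derived free_group (derived free_group (carrier free_group)) \<lhd> free_group"
    by (rule F.derived_is_normal)
  then show ?thesis unfolding free_metabelian_def by (rule normal.factorgroup_is_group)
qed

definition conj_by :: "('a, 'b) monoid_scheme \<Rightarrow> 'a \<Rightarrow> 'a \<Rightarrow> 'a" where
  "conj_by G x y = inv\<^bsub>G\<^esub> y \<otimes>\<^bsub>G\<^esub> x \<otimes>\<^bsub>G\<^esub> y"

definition commutator :: "('a, 'b) monoid_scheme \<Rightarrow> 'a \<Rightarrow> 'a \<Rightarrow> 'a" where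
  "commutator G x y = inv\<^bsub>G\<^esub> x \<otimes>\<^bsub>G\<^esub> inv\<^bsub>G\<^esub> y \<otimes>\<^bsub>G\<^esub> x \<otimes>\<^bsub>G\<^esub> y"

text \<open>
  poly_exp G g f h is the element written $g^{f(h)}$: the product, in order of increasing i,
  of the conjugates by $h^i$ of g to the power of the i-th coefficient of f.
\<close>

definition poly_exp :: "('a, 'b) monoid_scheme \<Rightarrow> 'a \<Rightarrow> int poly \<Rightarrow> 'a \<Rightarrow> 'a" where
  "poly_exp G g f h =
     foldr (\<otimes>\<^bsub>G\<^esub>)
       (map (\<lambda>i. conj_by G (g [^]\<^bsub>G\<^esub> coeff f i) (h [^]\<^bsub>G\<^esub> i)) [0..<Suc (degree f)]) \<one>\<^bsub>G\<^esub>"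

definition Psi :: "nat \<Rightarrow> int poly" where
  "Psi k = (\<Sum>i<k. monom 1 i)"

datatype two_gens = Gen_x | Gen_y

text \<open>K q r is $K(q, r)$; the theorem only concerns positive powers q, r of one prime.\<close>

definition K_relators :: "('a, 'b) monoid_scheme \<Rightarrow> 'a \<Rightarrow> 'a \<Rightarrow> nat \<Rightarrow> nat \<Rightarrow> 'a set" where
  "K_relators G x y q r =
     {commutator G (commutator G x y) (x [^]\<^bsub>G\<^esub> q),
      commutator G (commutator G x y) (y [^]\<^bsub>G\<^esub> r),
      poly_exp G (x [^]\<^bsub>G\<^esub> q) (Psi r) y,
      poly_exp G (y [^]\<^bsub>G\<^esub> r) (Psi q) x}"

definition K :: "nat \<Rightarrow> nat \<Rightarrow> (two_gens \<times> bool) list set set monoid" where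
  "K q r = free_metabelian Mod
     normal_closure free_metabelian
       (K_relators free_metabelian (free_metabelian_gen Gen_x) (free_metabelian_gen Gen_y) q r)"

text \<open>A defining relation $u = v$ is encoded by the relator $u v^{-1}$.\<close>

definition P_relators :: "('a, 'b) monoid_scheme \<Rightarrow> 'a \<Rightarrow> 'a \<Rightarrow> 'a set" where
  "P_relators G x y =
     {conj_by G (y [^]\<^bsub>G\<^esub> (2::int)) x \<otimes>\<^bsub>G\<^esub> inv\<^bsub>G\<^esub> (y [^]\<^bsub>G\<^esub> (-2::int)),
      conj_by G (x [^]\<^bsub>G\<^esub> (2::int)) y \<otimes>\<^bsub>G\<^esub> inv\<^bsub>G\<^esub> (x [^]\<^bsub>G\<^esub> (-2::int))}"

definition Promislow :: "(two_gens \<times> bool) list set monoid" where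
  "Promislow = free_group Mod
     normal_closure free_group (P_relators free_group (free_gen Gen_x) (free_gen Gen_y))"

section \<open>The generalized exponent\<close>

definition conj_class :: "('a, 'b) monoid_scheme \<Rightarrow> 'a \<Rightarrow> 'a set" where
  "conj_class G g = conj_by G g ` carrier G"

definition conj_classes :: "('a, 'b) monoid_scheme \<Rightarrow> 'a set set" where
  "conj_classes G = conj_class G ` carrier G"

primrec set_power :: "('a, 'b) monoid_scheme \<Rightarrow> 'a set \<Rightarrow> nat \<Rightarrow> 'a set" where
  "set_power G C 0 = {\<one>\<^bsub>G\<^esub>}"
| "set_power G C (Suc k) = set_power G C k <#>\<^bsub>G\<^esub> C"

definition all_classes_vanish :: "('a, 'b) monoid_scheme \<Rightarrow> nat \<Rightarrow> bool" where
  "all_classes_vanish G k \<longleftrightarrow> (\<forall>C \<in> conj_classes G. \<one>\<^bsub>G\<^esub> \<in> set_power G C k)"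

text \<open>
  The value 0 means that no such positive integer exists, so an equation gen_exp G = k
  with k positive includes the existence of the generalized exponent.
\<close>

definition gen_exp :: "('a, 'b) monoid_scheme \<Rightarrow> nat" where
  "gen_exp G = (if \<exists>k>0. all_classes_vanish G k
                then LEAST k. k > 0 \<and> all_classes_vanish G k else 0)"

end

theory Submission
  imports Defs "HOL-Algebra.Elementary_Groups" "HOL-Algebra.Multiplicative_Group"
begin

text \<open>
  Let G be generated by x and y, and let N be an abelian normal subgroup with quotient
  $\mathbb{Z}/q \times \mathbb{Z}/r$, the images of x and y being the standard generators. The transfer
  V from G to N is a homomorphism, and V(g) is a product of qr conjugates of g: each orbit
  of g on the cosets of N contributes a conjugate of a power of g whose exponent is the orbit
  length. The values V(x) and V(y) are the products
  $(x^q)^{\Psi_r(y)}$ and $(y^r)^{\Psi_q(x)}$, which are exactly the last two relators of K(q, r).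
  Hence V is trivial, and 1 is a product of qr conjugates of every g. Conversely, x has order qr in the
  abelianization, so qr divides every k such that 1 is a product of k conjugates of x.
  The Promislow group satisfies the same hypotheses with q = r = 2.
\<close>

text \<open>For K(q, r) the abelian normal subgroup is generated by the derived subgroup, x^q and
  y^r, and the relators force it to be abelian. The first two make x^q and y^r commute with [x, y],
  hence with the whole derived subgroup, which is abelian by metabelianness. The third makes x^q
  commute with y^r: if the product of the conjugates of u by t^0, ..., t^(k-1) is 1, then t^k
  centralizes u. In an abelian target the last two relators become qr-th powers of x and y. Hence
  the order of x in the abelianization equals the index of N, and the two bounds meet. The quotient
  is modelled by the concrete group Z/q x Z/r with the section (i, j) -> y^j x^i. On a generator the
  orbit representatives can then be taken to be powers of the other generator, so that the transfer
  is literally the relator. For the Promislow group no isomorphism with K(2) is needed: x^2, y^2 and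
  (xy)^2 generate an abelian normal subgroup, and the two norm conditions are its defining
  relations.\<close>

section \<open>Finite products, orbits of a cyclic group, conjugation\<close>

lemma (in comm_monoid) finprod_cartesian:
  assumes "finite S" "finite T" "\<And>a k. a \<in> S \<Longrightarrow> k \<in> T \<Longrightarrow> f a k \<in> carrier G"
  shows "finprod G (\<lambda>(a, k). f a k) (S \<times> T) = finprod G (\<lambda>a. finprod G (f a) T) S"
  using assms(1,3)
proof (induction S)
  case (insert a S)
  have "finprod G (\<lambda>(a, k). f a k) (insert a S \<times> T)
      = finprod G (\<lambda>(a, k). f a k) (Pair a ` T \<union> S \<times> T)"
    by (rule arg_cong[where f = "finprod G _"]) auto
  also have "\<dots> = finprod G (\<lambda>(a, k). f a k) (Pair a ` T) \<otimes> finprod G (\<lambda>(a, k). f a k) (S \<times> T)"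
    using insert assms(2) by (intro finprod_Un_disjoint) auto
  also have "finprod G (\<lambda>(a, k). f a k) (Pair a ` T) = finprod G (f a) T"
    using insert.prems by (subst finprod_reindex) (auto simp: inj_on_def)
  finally show ?case
    using insert by simp
qed simp

text \<open>The orbits of left multiplication by \<open>a\<close> are the right cosets of the cyclic
  group it generates. Choosing one point per orbit gives \<open>S\<close>, and exponents below
  \<open>ord a\<close> separate the points of an orbit.\<close>

lemma (in group) cyclic_transversal:
  assumes "finite (carrier G)" and a: "a \<in> carrier G"
  shows "\<exists>S \<subseteq> carrier G. bij_betw (\<lambda>(b, k). a [^] k \<otimes> b) (S \<times> {..<ord a}) (carrier G)"
proof -
  define C where "C c = (\<lambda>k. a [^] k \<otimes> c) ` {..<ord a}" for c
  define p where "p c = (SOME b. b \<in> C c)" for c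
  have pos: "ord a > 0"
    using assms ord_ge_1 by fastforce
  have red: "a [^] k \<otimes> c \<in> C c" for k :: nat and c
  proof -
    have "a [^] k = a [^] (k mod ord a)"
      using nat_pow_mult[of a "ord a * (k div ord a)" "k mod ord a"] a
      by (simp add: nat_pow_pow[symmetric])
    then show ?thesis
      using pos by (auto simp: C_def)
  qed
  have sub: "C (a [^] k \<otimes> c) \<subseteq> C c" if "c \<in> carrier G" for k :: nat and c
  proof -
    have "a [^] l \<otimes> (a [^] k \<otimes> c) \<in> C c" for l :: nat
      using red[of "l + k" c] a that by (simp add: nat_pow_mult m_assoc[symmetric])
    then show ?thesis by (auto simp: C_def[of "a [^] k \<otimes> c"])
  qed
  \<comment> \<open>The power \<open>a [^] (ord a - k)\<close> undoes the shift by
    \<open>a [^] k\<close>, so the inclusion \<open>sub\<close> can be used in both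
    directions.\<close>
  have eq: "C (a [^] k \<otimes> c) = C c" if "c \<in> carrier G" "k < ord a" for k :: nat and c
  proof -
    have "a [^] (ord a - k) \<otimes> (a [^] k \<otimes> c) = c"
      using that a by (simp add: m_assoc[symmetric] nat_pow_mult)
    then show ?thesis
      using sub[of c k] sub[of "a [^] k \<otimes> c" "ord a - k"] that a by simp
  qed
  have p: "p c \<in> C c" for c
    using red[of 0 c] unfolding p_def by (rule someI)
  have pC: "p c \<in> carrier G" "C (p c) = C c" if "c \<in> carrier G" for c
  proof -
    obtain k where "p c = a [^] k \<otimes> c" "k < ord a"
      using p[of c] by (auto simp: C_def)
    then show "p c \<in> carrier G" "C (p c) = C c"
      using eq that a by auto
  qed
  \<comment> \<open>The choice depends only on the orbit as a set, so equal orbits share their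
    representative.\<close>
  have pp: "p b = p c" if "C b = C c" for b c
    using that by (simp add: p_def)
  have "inj_on (\<lambda>(b, k). a [^] k \<otimes> b) (p ` carrier G \<times> {..<ord a})"
  proof (rule inj_onI, clarify)
    fix b c k l
    assume *: "b \<in> carrier G" "c \<in> carrier G" "k < ord a" "l < ord a"
      "a [^] k \<otimes> p b = a [^] l \<otimes> p c"
    have "C (p b) = C (p c)"
      using eq[of "p b" k] eq[of "p c" l] * pC by simp
    then have bc: "p b = p c"
      using pp pC * by metis
    then have "a [^] k = a [^] l"
      using * a pC by simp
    then have "k = l"
      using * ord_inj[OF a] by (auto dest!: inj_onD[where x = k and y = l])
    then show "p b = p c \<and> k = l"
      using bc by simp
  qed
  moreover have "c \<in> (\<lambda>(b, k). a [^] k \<otimes> b) ` (p ` carrier G \<times> {..<ord a})"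
    if "c \<in> carrier G" for c
  proof -
    have "c \<in> C (p c)"
      using red[of 0 c] pC[OF that] that by simp
    then obtain k where "c = a [^] k \<otimes> p c" "k < ord a"
      by (auto simp: C_def)
    then show ?thesis
      using that by (intro image_eqI[of _ _ "(p c, k)"]) auto
  qed
  ultimately have "bij_betw (\<lambda>(b, k). a [^] k \<otimes> b) (p ` carrier G \<times> {..<ord a}) (carrier G)"
    using pC a by (auto simp: bij_betw_def)
  then show ?thesis
    using pC by (intro exI[of _ "p ` carrier G"]) auto
qed

lemma (in group) set_power_add:
  assumes "C \<subseteq> carrier G" "u \<in> set_power G C k" "v \<in> set_power G C l"
  shows "u \<otimes> v \<in> set_power G C (k + l)"
  using assms(3)
proof (induction l arbitrary: v)
  case (Suc l)
  have sp: "set_power G C j \<subseteq> carrier G" for j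
    using assms(1) by (induction j) (auto simp: set_mult_closed)
  obtain w c where v: "v = w \<otimes> c" and w: "w \<in> set_power G C l" "c \<in> C"
    using Suc.prems by (auto simp: set_mult_def)
  have "u \<otimes> v = (u \<otimes> w) \<otimes> c"
    using v w assms sp by (metis m_assoc subsetD)
  then show ?case
    using Suc.IH[OF w(1)] w(2) by (auto simp: set_mult_def)
next
  case 0
  have "set_power G C k \<subseteq> carrier G"
    using assms(1) by (induction k) (auto simp: set_mult_closed)
  then show ?case
    using 0 assms by auto
qed

lemma (in group) pow_in_set_power: "c \<in> C \<Longrightarrow> c [^] k \<in> set_power G C k" for k :: nat
  by (induction k) (auto simp: set_mult_def)

lemma (in group) conj_by_closed [simp]:
  "u \<in> carrier G \<Longrightarrow> t \<in> carrier G \<Longrightarrow> conj_by G u t \<in> carrier G"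
  by (simp add: conj_by_def)

lemma (in group) conj_by_mult:
  assumes "u \<in> carrier G" "v \<in> carrier G" "t \<in> carrier G"
  shows "conj_by G (u \<otimes> v) t = conj_by G u t \<otimes> conj_by G v t"
proof -
  have "t \<otimes> (inv t \<otimes> z) = z" if "z \<in> carrier G" for z
    using that assms by (simp add: m_assoc[symmetric])
  then show ?thesis
    using assms by (simp add: conj_by_def m_assoc)
qed

lemma (in group) conj_by_conj_by:
  assumes "u \<in> carrier G" "s \<in> carrier G" "t \<in> carrier G"
  shows "conj_by G (conj_by G u s) t = conj_by G u (s \<otimes> t)"
  using assms by (simp add: conj_by_def m_assoc inv_mult_group)

lemma (in group) conj_by_one [simp]:
  "t \<in> carrier G \<Longrightarrow> conj_by G \<one> t = \<one>" "u \<in> carrier G \<Longrightarrow> conj_by G u \<one> = u"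
  by (simp_all add: conj_by_def)

lemma (in group) conj_by_group_hom:
  "t \<in> carrier G \<Longrightarrow> group_hom G G (\<lambda>u. conj_by G u t)"
  by unfold_locales (auto simp: hom_def conj_by_mult)

lemma (in group) conj_by_nat_pow:
  assumes "u \<in> carrier G" "t \<in> carrier G"
  shows "conj_by G (u [^] k) t = conj_by G u t [^] (k :: nat)"
  by (rule group_hom.hom_nat_pow[OF conj_by_group_hom[OF assms(2)] assms(1)])

lemma (in group) conj_by_inv:
  assumes "u \<in> carrier G" "t \<in> carrier G"
  shows "conj_by G (inv u) t = inv conj_by G u t"
  by (rule group_hom.hom_inv[OF conj_by_group_hom[OF assms(2)] assms(1)])

section \<open>Transfer to an abelian kernel\<close>

text \<open>\<open>H\<close> plays the part of the quotient by an abelian normal subgroup of finite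
  index. The section \<open>s\<close> is only a choice of coset representatives, not a homomorphism;
  its failure to be one is what the transfer measures.\<close>

locale abelian_kernel_section = group_hom +
  fixes s :: "'c \<Rightarrow> 'a"
  assumes finite_H: "finite (carrier H)"
    and section_closed: "a \<in> carrier H \<Longrightarrow> s a \<in> carrier G"
    and hom_section: "a \<in> carrier H \<Longrightarrow> h (s a) = a"
    and kernel_commute: "u \<in> kernel G H h \<Longrightarrow> v \<in> kernel G H h \<Longrightarrow> u \<otimes> v = v \<otimes> u"
begin

abbreviation "N \<equiv> G\<lparr>carrier := kernel G H h\<rparr>"

text \<open>The correction factor in
  \<open>g \<otimes> s a = s (h g \<otimes> a) \<otimes> slide a g\<close>, where \<open>g\<close>
  carries one coset representative to the next.\<close>

definition "slide a g = inv s (h g \<otimes>\<^bsub>H\<^esub> a) \<otimes> g \<otimes> s a"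

text \<open>The classical transfer (Verlagerung) into the kernel, written without an ordering of the
  cosets because the kernel is abelian.\<close>

definition "transfer g = finprod N (\<lambda>a. slide a g) (carrier H)"

text \<open>The rewrites present the operations of \<open>N\<close> as those of \<open>G\<close>, so
  that finite products in the kernel mix freely with computations in \<open>G\<close>.\<close>

sublocale N: comm_group N
  rewrites "carrier N = kernel G H h" and "\<one>\<^bsub>N\<^esub> = \<one>" and "(\<otimes>\<^bsub>N\<^esub>) = (\<otimes>)"
  using group.group_comm_groupI[OF G.subgroup_imp_group[OF subgroup_kernel]] kernel_commute
  by (simp_all)

lemma slide_kernel:
  assumes "a \<in> carrier H" "g \<in> carrier G"
  shows "slide a g \<in> kernel G H h"
  using assms by (simp add: slide_def kernel_def hom_section section_closed H.m_assoc)

text \<open>The cocycle identity: insert \<open>s b \<otimes> inv s b\<close> between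
  \<open>g\<close> and \<open>g'\<close> for the intermediate coset
  \<open>b = h g' \<otimes> a\<close>.\<close>

lemma slide_mult:
  assumes "a \<in> carrier H" "g \<in> carrier G" "g' \<in> carrier G"
  shows "slide a (g \<otimes> g') = slide (h g' \<otimes>\<^bsub>H\<^esub> a) g \<otimes> slide a g'"
proof -
  let ?b = "h g' \<otimes>\<^bsub>H\<^esub> a"
  have "s ?b \<otimes> (inv s ?b \<otimes> z) = z" if "z \<in> carrier G" for z
    using that assms by (simp add: G.m_assoc[symmetric] section_closed)
  then show ?thesis
    using assms by (simp add: slide_def G.m_assoc H.m_assoc section_closed)
qed

lemma transfer_kernel: "g \<in> carrier G \<Longrightarrow> transfer g \<in> kernel G H h"
  unfolding transfer_def using N.finprod_closed by (simp add: slide_kernel)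

text \<open>In the product of the cocycle identity over all cosets, left translation by
  \<open>h g'\<close> merely permutes the index set.\<close>

lemma transfer_mult:
  assumes "g \<in> carrier G" "g' \<in> carrier G"
  shows "transfer (g \<otimes> g') = transfer g \<otimes> transfer g'"
proof -
  have "bij_betw (\<lambda>a. h g' \<otimes>\<^bsub>H\<^esub> a) (carrier H) (carrier H)"
    using assms H.surj_const_mult H.inj_on_cmult by (simp add: bij_betw_def)
  then have inj: "inj_on (\<lambda>a. h g' \<otimes>\<^bsub>H\<^esub> a) (carrier H)"
    and img: "(\<lambda>a. h g' \<otimes>\<^bsub>H\<^esub> a) ` carrier H = carrier H"
    by (auto simp: bij_betw_def)
  have "transfer g = finprod N (\<lambda>a. slide (h g' \<otimes>\<^bsub>H\<^esub> a) g) (carrier H)"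
    unfolding transfer_def using N.finprod_reindex[OF _ inj, of "\<lambda>a. slide a g"] assms
    by (simp add: img slide_kernel)
  moreover have "transfer (g \<otimes> g')
      = finprod N (\<lambda>a. slide (h g' \<otimes>\<^bsub>H\<^esub> a) g \<otimes> slide a g') (carrier H)"
    unfolding transfer_def
    by (rule N.finprod_cong') (use assms in \<open>auto simp: slide_mult slide_kernel intro: N.m_closed\<close>)
  ultimately show ?thesis
    using assms by (simp add: transfer_def slide_kernel)
qed

lemma transfer_trivial:
  assumes gen: "generate G X = carrier G" and X: "X \<subseteq> carrier G"
    and triv: "\<And>x. x \<in> X \<Longrightarrow> transfer x = \<one>" and g: "g \<in> carrier G"
  shows "transfer g = \<one>"
proof -
  have 1: "transfer \<one> = \<one>"
    using transfer_mult[of \<one> \<one>] transfer_kernel[of \<one>]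
    by (simp add: kernel_def)
  have "g \<in> generate G X"
    using g gen by simp
  then show ?thesis
  proof (induction rule: generate.induct)
    case (inv x)
    then show ?case
      using transfer_mult[of "inv x" x] transfer_kernel[of "inv x"] triv X 1
      by (auto simp: kernel_def)
  next
    case (eng x y)
    then show ?case
      using gen by (simp add: transfer_mult)
  qed (auto simp: 1 triv)
qed

text \<open>The product telescopes along an orbit of g, which makes the transfer a product of conjugates.\<close>

lemma finprod_slide_orbit:
  fixes f :: nat
  assumes a: "a \<in> carrier H" and g: "g \<in> carrier G"
  shows "finprod N (\<lambda>k. slide (h g [^]\<^bsub>H\<^esub> k \<otimes>\<^bsub>H\<^esub> a) g) {..<f}
    = inv s (h g [^]\<^bsub>H\<^esub> f \<otimes>\<^bsub>H\<^esub> a) \<otimes> g [^] f \<otimes> s a"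
proof (induction f)
  case 0
  then show ?case using a by (simp add: section_closed)
next
  case (Suc f)
  let ?b = "h g [^]\<^bsub>H\<^esub> f \<otimes>\<^bsub>H\<^esub> a"
  have b: "?b \<in> carrier H" "s ?b \<in> carrier G" using a g by (auto simp: section_closed)
  have *: "s ?b \<otimes> (inv s ?b \<otimes> z) = z" if "z \<in> carrier G" for z
    using that b by (simp add: G.m_assoc[symmetric])
  have hb: "h g \<otimes>\<^bsub>H\<^esub> ?b = h g [^]\<^bsub>H\<^esub> Suc f \<otimes>\<^bsub>H\<^esub> a"
    using a g H.nat_pow_Suc2[of "h g" f] by (simp add: H.m_assoc)
  have "finprod N (\<lambda>k. slide (h g [^]\<^bsub>H\<^esub> k \<otimes>\<^bsub>H\<^esub> a) g) {..<Suc f}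
    = slide ?b g \<otimes> finprod N (\<lambda>k. slide (h g [^]\<^bsub>H\<^esub> k \<otimes>\<^bsub>H\<^esub> a) g) {..<f}"
    unfolding lessThan_Suc using a g by (intro N.finprod_insert) (auto simp: slide_kernel)
  also have "\<dots> = inv s (h g \<otimes>\<^bsub>H\<^esub> ?b) \<otimes> g \<otimes> s ?b \<otimes> (inv s ?b \<otimes> g [^] f \<otimes> s a)"
    by (simp only: Suc.IH slide_def[of ?b])
  also have "\<dots> = inv s (h g \<otimes>\<^bsub>H\<^esub> ?b) \<otimes> g [^] Suc f \<otimes> s a"
    using a g b * G.nat_pow_Suc2[of g f] by (simp add: G.m_assoc section_closed del: G.nat_pow_Suc)
  finally show ?case by (simp only: hb)
qed

lemma conj_by_kernel:
  assumes "g \<in> carrier G" "h g [^]\<^bsub>H\<^esub> (f :: nat) = \<one>\<^bsub>H\<^esub>" "a \<in> carrier H"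
  shows "conj_by G (g [^] f) (s a) \<in> kernel G H h"
  using assms by (simp add: kernel_def conj_by_def hom_section section_closed hom_nat_pow)

text \<open>Since the \<open>f\<close>-th power of \<open>h g\<close> is trivial, each orbit closes
  up and its telescoped product is the conjugate of \<open>g [^] f\<close> by \<open>s a\<close>.
  The transversal is a parameter rather than a chosen one, so that explicit transversals can be
  supplied for the generators.\<close>

lemma transfer_eq_finprod_conj:
  assumes g: "g \<in> carrier G" and S: "S \<subseteq> carrier H" and f: "h g [^]\<^bsub>H\<^esub> (f :: nat) = \<one>\<^bsub>H\<^esub>"
    and bij: "bij_betw (\<lambda>(a, k). h g [^]\<^bsub>H\<^esub> k \<otimes>\<^bsub>H\<^esub> a) (S \<times> {..<f}) (carrier H)"
  shows "transfer g = finprod N (\<lambda>a. conj_by G (g [^] f) (s a)) S"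
proof -
  have fin: "finite S" using S finite_H by (rule finite_subset)
  have "transfer g = finprod N (\<lambda>b. slide b g) ((\<lambda>(a, k). h g [^]\<^bsub>H\<^esub> k \<otimes>\<^bsub>H\<^esub> a) ` (S \<times> {..<f}))"
    using bij by (simp add: transfer_def bij_betw_def)
  also have "\<dots> = finprod N (\<lambda>(a, k). slide (h g [^]\<^bsub>H\<^esub> k \<otimes>\<^bsub>H\<^esub> a) g) (S \<times> {..<f})"
    using bij g S by (subst N.finprod_reindex)
      (auto simp: bij_betw_def slide_kernel case_prod_unfold)
  also have "\<dots> = finprod N (\<lambda>a. finprod N (\<lambda>k. slide (h g [^]\<^bsub>H\<^esub> k \<otimes>\<^bsub>H\<^esub> a) g) {..<f}) S"
    using fin S g by (intro N.finprod_cartesian) (auto simp: slide_kernel)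
  also have "\<dots> = finprod N (\<lambda>a. conj_by G (g [^] f) (s a)) S"
  proof (rule N.finprod_cong')
    fix a assume "a \<in> S"
    then show "finprod N (\<lambda>k. slide (h g [^]\<^bsub>H\<^esub> k \<otimes>\<^bsub>H\<^esub> a) g) {..<f} = conj_by G (g [^] f) (s a)"
      using S g f by (subst finprod_slide_orbit) (auto simp: conj_by_def)
  next
    show "(\<lambda>a. conj_by G (g [^] f) (s a)) \<in> S \<rightarrow> kernel G H h"
      using S g f by (auto intro!: conj_by_kernel)
  qed simp
  finally show ?thesis .
qed

lemma transfer_in_set_power:
  assumes g: "g \<in> carrier G"
  shows "transfer g \<in> set_power G (conj_class G g) (card (carrier H))"
proof -
  let ?f = "H.ord (h g)"
  obtain S where S: "S \<subseteq> carrier H"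
    and bij: "bij_betw (\<lambda>(a, k). h g [^]\<^bsub>H\<^esub> k \<otimes>\<^bsub>H\<^esub> a) (S \<times> {..<?f}) (carrier H)"
    using H.cyclic_transversal[OF finite_H hom_closed[OF g]] by (elim exE conjE) (rule that)
  have fin: "finite S" using S finite_H by (rule finite_subset)
  have sub: "conj_class G g \<subseteq> carrier G"
    using g by (auto simp: conj_class_def)
  have "finprod N (\<lambda>a. conj_by G (g [^] ?f) (s a)) S
      \<in> set_power G (conj_class G g) (card S * ?f)"
    using fin S
  proof (induction S)
    case (insert a S)
    \<comment> \<open>A conjugate of a power is the power of one conjugate, so each orbit accounts
      for \<open>?f\<close> equal factors from the class of \<open>g\<close>.\<close>
    have "conj_by G (g [^] ?f) (s a) \<in> set_power G (conj_class G g) ?f"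
      using insert.prems g
      by (simp add: G.conj_by_nat_pow section_closed)
        (auto simp: conj_class_def section_closed intro!: G.pow_in_set_power)
    then have "conj_by G (g [^] ?f) (s a) \<otimes> finprod N (\<lambda>a. conj_by G (g [^] ?f) (s a)) S
        \<in> set_power G (conj_class G g) (?f + card S * ?f)"
      using insert by (intro G.set_power_add sub) auto
    then show ?case
      using insert conj_by_kernel[OF g H.pow_ord_eq_1] g by (subst N.finprod_insert) auto
  qed simp
  \<comment> \<open>All orbits have the same length, so the factors number exactly the order of
    \<open>H\<close>.\<close>
  moreover have "card S * ?f = card (carrier H)"
    using bij_betw_same_card[OF bij] by (simp add: card_cartesian_product)
  ultimately show ?thesis
    using transfer_eq_finprod_conj[OF g S _ bij] g by simp
qed

end

section \<open>Groups with two generators\<close>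

text \<open>Connects the ordered products in the relators with the unordered products of the
  transfer. The tail \<open>z\<close> is arbitrary because the induction splits off the last index,
  whose factor is absorbed into the tail.\<close>

lemma (in comm_monoid) foldr_eq_finprod:
  assumes "f \<in> {..<n} \<rightarrow> carrier G" "z \<in> carrier G"
  shows "foldr (\<otimes>) (map f [0..<n]) z = finprod G f {..<n} \<otimes> z"
  using assms
proof (induction n arbitrary: z)
  case (Suc n)
  then have "f \<in> {..<n} \<rightarrow> carrier G" "f n \<in> carrier G" by auto
  with Suc show ?case
    by (simp add: lessThan_Suc m_ac)
qed simp

text \<open>Centralizers are subgroups. That of \<open>S\<close> contains
  \<open>generate G S\<close>, so \<open>S\<close> lies in the centralizer of
  \<open>generate G S\<close>, which therefore contains \<open>generate G S\<close> as well.\<close>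

lemma (in group) generate_commute:
  assumes S: "S \<subseteq> carrier G" and comm: "\<And>s t. s \<in> S \<Longrightarrow> t \<in> S \<Longrightarrow> s \<otimes> t = t \<otimes> s"
    and uv: "u \<in> generate G S" "v \<in> generate G S"
  shows "u \<otimes> v = v \<otimes> u"
proof -
  let ?Z = "\<lambda>T. {g \<in> carrier G. \<forall>t\<in>T. g \<otimes> t = t \<otimes> g}"
  have Z: "subgroup (?Z T) G" if T: "T \<subseteq> carrier G" for T
  proof (rule subgroupI)
    fix a assume a: "a \<in> ?Z T"
    have "inv a \<otimes> t = t \<otimes> inv a" if "t \<in> T" for t
    proof -
      have at: "a \<in> carrier G" "t \<in> carrier G" "a \<otimes> t = t \<otimes> a"
        using a that T by auto
      have "inv a \<otimes> t = inv a \<otimes> (t \<otimes> a) \<otimes> inv a"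
        using at(1,2) by (simp add: m_assoc)
      also have "\<dots> = t \<otimes> inv a"
        unfolding at(3)[symmetric] using at(1,2) by (simp add: m_assoc[symmetric])
      finally show ?thesis .
    qed
    then show "inv a \<in> ?Z T" using a by auto
  next
    fix a b assume ab: "a \<in> ?Z T" "b \<in> ?Z T"
    have "a \<otimes> b \<otimes> t = t \<otimes> (a \<otimes> b)" if "t \<in> T" for t
    proof -
      have t: "a \<in> carrier G" "b \<in> carrier G" "t \<in> carrier G" "a \<otimes> t = t \<otimes> a" "b \<otimes> t = t \<otimes> b"
        using ab that T by auto
      have "a \<otimes> b \<otimes> t = a \<otimes> t \<otimes> b" using t(1-3,5) by (simp only: m_assoc)
      also have "\<dots> = t \<otimes> (a \<otimes> b)" using t(1-4) by (simp only: m_assoc)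
      finally show ?thesis .
    qed
    then show "a \<otimes> b \<in> ?Z T" using ab by auto
  qed (use T in \<open>auto intro!: exI[of _ \<one>] simp: subset_iff\<close>)
  have gen: "generate G S \<subseteq> carrier G"
    using S by (rule generate_incl)
  have "generate G S \<subseteq> ?Z S"
    by (rule generate_subgroup_incl[OF _ Z[OF S]]) (use S comm in auto)
  then have "S \<subseteq> ?Z (generate G S)" using S by force
  then have "generate G S \<subseteq> ?Z (generate G S)"
    by (rule generate_subgroup_incl[OF _ Z[OF gen]])
  then show ?thesis using uv by auto
qed

lemma (in normal) group_hom_Mod: "group_hom G (G Mod H) (\<lambda>a. H #> a)"
  using r_coset_hom_Mod factorgroup_is_group
  by (simp add: group_hom_def group_hom_axioms_def is_group)

lemma (in normal) Mod_eq_one_iff: "a \<in> carrier G \<Longrightarrow> H #> a = H \<longleftrightarrow> a \<in> H"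
  using rcos_self subgroup_axioms coset_join2 by metis

lemma (in group_hom) hom_commutator:
  "u \<in> carrier G \<Longrightarrow> v \<in> carrier G \<Longrightarrow> h (commutator G u v) = commutator H (h u) (h v)"
  by (simp add: commutator_def)

lemma (in group) commutator_closed [simp]:
  "u \<in> carrier G \<Longrightarrow> v \<in> carrier G \<Longrightarrow> commutator G u v \<in> carrier G"
  by (simp add: commutator_def)

lemma (in group) commutator_eq_one_iff:
  assumes "u \<in> carrier G" "v \<in> carrier G"
  shows "commutator G u v = \<one> \<longleftrightarrow> u \<otimes> v = v \<otimes> u"
proof -
  have "commutator G u v = inv (v \<otimes> u) \<otimes> (u \<otimes> v)"
    using assms by (simp add: commutator_def inv_mult_group m_assoc)
  then show ?thesis
    using assms by (metis inv_closed inv_equality inv_inv l_inv m_closed)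
qed

text \<open>The quotient is generated by the images of \<open>x\<close> and \<open>y\<close>, and
  these commute as soon as their single commutator dies.\<close>

lemma (in group) comm_group_Mod_commutator:
  assumes "Z \<lhd> G" and gen: "generate G {x, y} = carrier G"
    and xy: "x \<in> carrier G" "y \<in> carrier G" and c: "commutator G x y \<in> Z"
  shows "comm_group (G Mod Z)"
proof -
  interpret Z: normal Z G by fact
  interpret Q: group_hom G "G Mod Z" "\<lambda>a. Z #> a" by (rule Z.group_hom_Mod)
  have "commutator (G Mod Z) (Z #> x) (Z #> y) = \<one>\<^bsub>G Mod Z\<^esub>"
    using c xy Z.Mod_eq_one_iff by (simp add: Q.hom_commutator[symmetric])
  then have "(Z #> x) \<otimes>\<^bsub>G Mod Z\<^esub> (Z #> y) = (Z #> y) \<otimes>\<^bsub>G Mod Z\<^esub> (Z #> x)"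
    using xy Q.hom_closed Q.H.commutator_eq_one_iff by blast
  moreover have "carrier (G Mod Z) = generate (G Mod Z) {Z #> x, Z #> y}"
    using Q.generate_img[of "{x, y}"] xy gen by (simp add: carrier_FactGroup)
  ultimately show ?thesis
    using Q.H.generate_commute[of "{Z #> x, Z #> y}"] xy Q.hom_closed
    by (intro Q.H.group_comm_groupI) (simp_all del: mult_FactGroup, blast)
qed

lemma (in comm_group) generate_two:
  assumes "x \<in> carrier G" "y \<in> carrier G" "g \<in> generate G {x, y}"
  shows "\<exists>(i :: int) (j :: int). g = y [^] j \<otimes> x [^] i"
  using assms(3)
proof induction
  case one
  then show ?case by (intro exI[of _ 0]) simp
next
  case (incl g)
  then consider "g = x" | "g = y" by blast
  then show ?case
  proof cases
    case 1
    then show ?thesis using assms by (intro exI[of _ 1] exI[of _ 0]) simp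
  next
    case 2
    then show ?thesis using assms by (intro exI[of _ 0] exI[of _ 1]) simp
  qed
next
  case (inv g)
  then consider "g = x" | "g = y" by blast
  then show ?case
  proof cases
    case 1
    then show ?thesis using assms by (intro exI[of _ "-1"] exI[of _ 0]) (simp add: int_pow_neg)
  next
    case 2
    then show ?thesis using assms by (intro exI[of _ 0] exI[of _ "-1"]) (simp add: int_pow_neg)
  qed
next
  case (eng g g')
  then obtain i j i' j' :: int
    where *: "g = y [^] j \<otimes> x [^] i" "g' = y [^] j' \<otimes> x [^] i'"
    by blast
  have "g \<otimes> g' = y [^] (j + j') \<otimes> x [^] (i + i')"
    using assms by (simp add: * int_pow_mult m_ac)
  then show ?case by blast
qed

text \<open>Lifts the normal form of the abelian quotient. The order, \<open>y\<close> before
  \<open>x\<close>, is that of the section used for the transfer.\<close>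

lemma (in group) two_generator_normal_form:
  assumes "Z \<lhd> G" and gen: "generate G {x, y} = carrier G"
    and xy: "x \<in> carrier G" "y \<in> carrier G" and comm: "comm_group (G Mod Z)"
    and g: "g \<in> carrier G"
  shows "\<exists>(i :: int) (j :: int). g \<otimes> inv (y [^] j \<otimes> x [^] i) \<in> Z"
proof -
  interpret Z: normal Z G by fact
  interpret Q: group_hom G "G Mod Z" "\<lambda>a. Z #> a" by (rule Z.group_hom_Mod)
  have "Z #> g \<in> generate (G Mod Z) {Z #> x, Z #> y}"
    using Q.generate_img[of "{x, y}"] xy gen g by simp
  then obtain i j :: int where "Z #> g = (Z #> y) [^]\<^bsub>G Mod Z\<^esub> j \<otimes>\<^bsub>G Mod Z\<^esub> (Z #> x) [^]\<^bsub>G Mod Z\<^esub> i"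
    using comm_group.generate_two[OF comm] xy Q.hom_closed by blast
  also have "\<dots> = Z #> (y [^] j \<otimes> x [^] i)"
    using xy by (simp only: Q.hom_int_pow Q.hom_mult int_pow_closed)
  finally have "g \<in> Z #> (y [^] j \<otimes> x [^] i)"
    using g rcos_self[OF _ Z.subgroup_axioms] by metis
  then show ?thesis
    using g xy Z.rcos_module_imp by blast
qed

section \<open>A criterion for the generalized exponent\<close>

text \<open>A homomorphism to an abelian group is constant on conjugacy classes, so
  \<open>\<alpha>\<close> takes the value \<open>k\<close> modulo \<open>d\<close> on every product
  of \<open>k\<close> conjugates of \<open>x\<close>; if 1 is such a product, this value is
  0.\<close>

lemma (in group) gen_exp_dvd:
  assumes "\<alpha> \<in> hom G (integer_mod_group d)" "x \<in> carrier G" "\<alpha> x = 1 mod int d"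
    and "all_classes_vanish G k"
  shows "d dvd k"
proof -
  interpret \<alpha>: group_hom G "integer_mod_group d" \<alpha>
    using assms(1) by (simp add: group_hom_def group_hom_axioms_def is_group)
  interpret A: comm_group "integer_mod_group d" by simp
  have conj: "\<alpha> u = 1 mod int d" "u \<in> carrier G" if u: "u \<in> conj_class G x" for u
  proof -
    obtain t where "t \<in> carrier G" "u = inv t \<otimes> x \<otimes> t"
      using u by (auto simp: conj_class_def conj_by_def)
    moreover from this have "\<alpha> u = \<alpha> x \<otimes>\<^bsub>integer_mod_group d\<^esub> inv\<^bsub>integer_mod_group d\<^esub> \<alpha> t \<otimes>\<^bsub>integer_mod_group d\<^esub> \<alpha> t"
      using assms(2) A.m_comm[of "\<alpha> x"] by (simp del: inv_integer_mod_group mult_integer_mod_group)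
    then have "\<alpha> u = \<alpha> x"
      using assms(2) \<open>t \<in> carrier G\<close>
      by (simp add: \<alpha>.H.m_assoc del: inv_integer_mod_group mult_integer_mod_group one_integer_mod_group)
    ultimately show "\<alpha> u = 1 mod int d" "u \<in> carrier G"
      using assms(2,3) by auto
  qed
  have "u \<in> carrier G \<and> \<alpha> u = int k mod int d" if "u \<in> set_power G (conj_class G x) k" for u k
    using that
  proof (induction k arbitrary: u)
    case 0
    then show ?case by (simp add: \<alpha>.hom_one[simplified])
  next
    case (Suc k)
    then obtain v w where "u = v \<otimes> w" "v \<in> set_power G (conj_class G x) k" "w \<in> conj_class G x"
      by (auto simp: set_mult_def)
    then show ?case
      using Suc.IH[of v] conj[of w] \<alpha>.hom_mult[of v w] by (simp add: mod_simps add.commute)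
  qed
  moreover have "\<one> \<in> set_power G (conj_class G x) k"
    using assms(2,4) by (auto simp: all_classes_vanish_def conj_classes_def)
  ultimately have "int k mod int d = 0"
    using \<alpha>.hom_one by force
  then show ?thesis
    by (metis mod_eq_0_iff_dvd of_nat_dvd_iff)
qed

text \<open>The common criterion for K(q, r) and the Promislow group. The maps
  \<open>\<alpha>\<close> and \<open>\<beta>\<close> are coordinates on the abelianization: reduced
  modulo \<open>q\<close> and \<open>r\<close> they define the quotient for the transfer, and
  unreduced \<open>\<alpha>\<close> gives the lower bound. The conditions \<open>rel\<close> say
  that the transfer kills \<open>x\<close> and \<open>y\<close>.\<close>

lemma (in group) gen_exp_eq:
  fixes q r :: nat
  defines "A \<equiv> integer_mod_group (q * r)"
  assumes q: "q > 0" and r: "r > 0"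
    and gen: "generate G {x, y} = carrier G" and x: "x \<in> carrier G" and y: "y \<in> carrier G"
    and Z: "Z \<lhd> G" and Z_commute: "\<And>u v. u \<in> Z \<Longrightarrow> v \<in> Z \<Longrightarrow> u \<otimes> v = v \<otimes> u"
    and mem: "commutator G x y \<in> Z" "x [^] q \<in> Z" "y [^] r \<in> Z"
    and rel: "foldr (\<otimes>) (map (\<lambda>j. conj_by G (x [^] q) (y [^] j)) [0..<r]) \<one> = \<one>"
      "foldr (\<otimes>) (map (\<lambda>i. conj_by G (y [^] r) (x [^] i)) [0..<q]) \<one> = \<one>"
    and \<alpha>: "\<alpha> \<in> hom G A" "\<alpha> x = 1 mod int (q * r)" "\<alpha> y = 0"
    and \<beta>: "\<beta> \<in> hom G A" "\<beta> x = 0" "\<beta> y = 1 mod int (q * r)"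
  shows "gen_exp G = q * r"
proof -
  define B where "B = integer_mod_group q \<times>\<times> integer_mod_group r"
  \<comment> \<open>Reducing values modulo \<open>q * r\<close> further to \<open>q\<close> and to
    \<open>r\<close> is compatible with addition, as both divide \<open>q * r\<close>.\<close>
  define h where "h g = (\<alpha> g mod int q, \<beta> g mod int r)" for g
  define s where "s a = y [^] snd a \<otimes> x [^] fst a" for a :: "int \<times> int"
  interpret \<alpha>: group_hom G A \<alpha>
    using \<alpha>(1) by (simp add: A_def group_hom_def group_hom_axioms_def is_group)
  interpret \<beta>: group_hom G A \<beta>
    using \<beta>(1) by (simp add: A_def group_hom_def group_hom_axioms_def is_group)
  interpret B: group B
    unfolding B_def by (intro DirProd_group) simp_all
  have carrier_B: "carrier B = {0..<int q} \<times> {0..<int r}"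
    using q r by (simp add: B_def carrier_integer_mod_group)
  have mult_B: "a \<otimes>\<^bsub>B\<^esub> b = ((fst a + fst b) mod int q, (snd a + snd b) mod int r)" for a b
    by (simp add: B_def mult_DirProd' case_prod_unfold)
  have one_B: "\<one>\<^bsub>B\<^esub> = (0, 0)"
    by (simp add: B_def)
  have "h \<in> hom G B"
  proof (rule homI)
    fix g g' assume "g \<in> carrier G" "g' \<in> carrier G"
    then show "h (g \<otimes> g') = h g \<otimes>\<^bsub>B\<^esub> h g'"
      using \<alpha>.hom_mult[of g g'] \<beta>.hom_mult[of g g']
      by (simp add: h_def mult_B A_def mod_mod_cancel mod_simps)
  qed (use q r in \<open>simp add: h_def carrier_B\<close>)
  then interpret h: group_hom G B h
    by (simp add: group_hom_def group_hom_axioms_def is_group B.is_group)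
  have \<alpha>_pow: "\<alpha> (x [^] i) mod int q = i mod int q" "\<alpha> (y [^] i) = 0" for i :: int
    using x y \<alpha>
    by (simp_all add: \<alpha>.hom_int_pow int_pow_integer_mod_group A_def mod_mod_cancel mod_simps)
  have \<beta>_pow: "\<beta> (x [^] i) = 0" "\<beta> (y [^] i) mod int r = i mod int r" for i :: int
    using x y \<beta>
    by (simp_all add: \<beta>.hom_int_pow int_pow_integer_mod_group A_def mod_mod_cancel mod_simps)
  have h_pow: "h (x [^] i) = (i mod int q, 0)" "h (y [^] i) = (0, i mod int r)" for i :: int
    by (simp_all add: h_def \<alpha>_pow \<beta>_pow)
  have h_pow_nat: "h x [^]\<^bsub>B\<^esub> (k :: nat) = (int k mod int q, 0)"
    "h y [^]\<^bsub>B\<^esub> (k :: nat) = (0, int k mod int r)" for k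
    using h_pow[of "int k"] x y by (simp_all add: int_pow_int h.hom_nat_pow)
  have h_s: "h (s a) = (fst a mod int q, snd a mod int r)" for a
    using x y by (simp add: s_def h_pow mult_B)
  text \<open>Z need not lie in the kernel, but its intersection with the kernel already has index qr.\<close>
  define Z' where "Z' = Z \<inter> kernel G B h"
  interpret Z': normal Z' G
    unfolding Z'_def using Z h.normal_kernel by (rule normal_subgroup_intersect)
  have "h (commutator G x y) = (0, 0)"
  proof -
    have "comm_group B"
      by (rule B.group_comm_groupI) (simp add: mult_B add.commute)
    then have "commutator B (h x) (h y) = \<one>\<^bsub>B\<^esub>"
      using x y by (simp add: B.commutator_eq_one_iff comm_groupE(4))
    then show ?thesis
      using x y by (simp add: h.hom_commutator one_B)
  qed
  moreover have "h (x [^] q) = (0, 0)" "h (y [^] r) = (0, 0)"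
    using h_pow_nat(1)[of q] h_pow_nat(2)[of r] by (simp_all only: h.hom_nat_pow[OF x] h.hom_nat_pow[OF y] mod_self)
  ultimately have mem': "commutator G x y \<in> Z'" "x [^] q \<in> Z'" "y [^] r \<in> Z'"
    using mem x y by (simp_all only: Z'_def kernel_def one_B Int_iff mem_Collect_eq
      commutator_closed nat_pow_closed simp_thms)
  \<comment> \<open>Modulo \<open>Z'\<close> an element is \<open>y [^] j \<otimes> x [^] i\<close>.
    If it lies in the kernel, then \<open>q\<close> divides \<open>i\<close> and \<open>r\<close>
    divides \<open>j\<close>, so this word is built from powers of \<open>x [^] q\<close> and
    \<open>y [^] r\<close> and lies in \<open>Z'\<close> too.\<close>
  have ker: "kernel G B h \<subseteq> Z'"
  proof
    fix g assume "g \<in> kernel G B h"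
    then have g: "g \<in> carrier G" "h g = (0, 0)"
      by (auto simp: kernel_def one_B)
    obtain i j :: int where "g \<otimes> inv (y [^] j \<otimes> x [^] i) \<in> Z'"
      using two_generator_normal_form[OF Z'.normal_axioms gen x y _ g(1)]
        comm_group_Mod_commutator[OF Z'.normal_axioms gen x y mem'(1)] by blast
    moreover define w where "w = y [^] j \<otimes> x [^] i"
    ultimately have ij: "g \<otimes> inv w \<in> Z'" by simp
    have w: "w \<in> carrier G" using x y by (simp add: w_def)
    have "h g = h (g \<otimes> inv w \<otimes> w)"
      using g w by (simp add: m_assoc)
    also have "\<dots> = h (g \<otimes> inv w) \<otimes>\<^bsub>B\<^esub> h w"
      using g w by (intro h.hom_mult m_closed inv_closed)
    also have "h (g \<otimes> inv w) = \<one>\<^bsub>B\<^esub>"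
      using ij by (simp only: Z'_def kernel_def Int_iff mem_Collect_eq)
    finally have "h w = (0, 0)"
      using g(2) w by simp
    then have "i mod int q = 0" "j mod int r = 0"
      using h_s[of "(i, j)"] by (auto simp: s_def w_def)
    then obtain k l where "i = int q * k" "j = int r * l"
      by (auto elim!: dvdE simp flip: dvd_eq_mod_eq_0)
    then have "x [^] i = (x [^] q) [^] k" "y [^] j = (y [^] r) [^] l"
      using x y by (simp_all add: int_pow_pow[symmetric] int_pow_int)
    then have "w \<in> Z'"
      using mem'(2,3) subgroup_int_pow_closed[OF Z'.subgroup_axioms] by (simp only: w_def Z'.m_closed)
    with ij have "g \<otimes> inv w \<otimes> w \<in> Z'"
      by (rule Z'.m_closed)
    then show "g \<in> Z'"
      using g w by (simp add: m_assoc)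
  qed
  interpret T: abelian_kernel_section G B h s
  proof unfold_locales
    show "h (s a) = a" if "a \<in> carrier B" for a
      using that by (auto simp: h_s carrier_B)
    show "u \<otimes> v = v \<otimes> u" if "u \<in> kernel G B h" "v \<in> kernel G B h" for u v
      using that ker Z_commute by (auto simp: Z'_def)
  qed (use x y in \<open>auto simp: carrier_B s_def\<close>)
  have "T.transfer x = \<one>"
  proof -
    let ?\<iota> = "\<lambda>j. (0, int j)"
    \<comment> \<open>Translation by \<open>h x\<close> changes only the first coordinate, so its
      orbits have length \<open>q\<close> and are indexed by the second; the representative
      \<open>(0, j)\<close> has the section value \<open>y [^] j\<close>.\<close>
    have bij: "bij_betw (\<lambda>(a, k). h x [^]\<^bsub>B\<^esub> k \<otimes>\<^bsub>B\<^esub> a) (?\<iota> ` {..<r} \<times> {..<q}) (carrier B)"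
    proof (rule bij_betw_imageI)
      have "(i, j) \<in> (\<lambda>(a, k). h x [^]\<^bsub>B\<^esub> k \<otimes>\<^bsub>B\<^esub> a) ` (?\<iota> ` {..<r} \<times> {..<q})"
        if "0 \<le> i" "i < int q" "0 \<le> j" "j < int r" for i j
        using that by (intro image_eqI[of _ _ "(?\<iota> (nat j), nat i)"])
          (auto simp: h_pow_nat mult_B intro!: image_eqI[where x = "nat j"])
      then show "(\<lambda>(a, k). h x [^]\<^bsub>B\<^esub> k \<otimes>\<^bsub>B\<^esub> a) ` (?\<iota> ` {..<r} \<times> {..<q}) = carrier B"
        using q r by (auto simp: carrier_B h_pow_nat mult_B)
    qed (auto simp: inj_on_def h_pow_nat mult_B)
    have mem_ker: "conj_by G (x [^] q) (y [^] j) \<in> kernel G B h" for j :: nat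
      using x y h_pow_nat(1)[of q]
      by (simp add: kernel_def conj_by_def h.hom_nat_pow one_B[symmetric])
    have "T.transfer x = finprod T.N (\<lambda>a. conj_by G (x [^] q) (s a)) (?\<iota> ` {..<r})"
      using h_pow_nat(1)[of q] x by (intro T.transfer_eq_finprod_conj bij) (auto simp: carrier_B one_B q)
    also have "\<dots> = finprod T.N (\<lambda>j. conj_by G (x [^] q) (y [^] j)) {..<r}"
      using x y mem_ker
      by (subst T.N.finprod_reindex) (auto simp: inj_on_def s_def int_pow_int)
    also have "\<dots> = \<one>"
      using T.N.foldr_eq_finprod[of "\<lambda>j. conj_by G (x [^] q) (y [^] j)" r \<one>] mem_ker rel(1)
      by (simp add: T.N.finprod_closed Pi_iff)
    finally show ?thesis .
  qed
  moreover have "T.transfer y = \<one>"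
  proof -
    let ?\<iota> = "\<lambda>i. (int i, 0)"
    have bij: "bij_betw (\<lambda>(a, k). h y [^]\<^bsub>B\<^esub> k \<otimes>\<^bsub>B\<^esub> a) (?\<iota> ` {..<q} \<times> {..<r}) (carrier B)"
    proof (rule bij_betw_imageI)
      have "(i, j) \<in> (\<lambda>(a, k). h y [^]\<^bsub>B\<^esub> k \<otimes>\<^bsub>B\<^esub> a) ` (?\<iota> ` {..<q} \<times> {..<r})"
        if "0 \<le> i" "i < int q" "0 \<le> j" "j < int r" for i j
        using that by (intro image_eqI[of _ _ "(?\<iota> (nat i), nat j)"])
          (auto simp: h_pow_nat mult_B intro!: image_eqI[where x = "nat i"])
      then show "(\<lambda>(a, k). h y [^]\<^bsub>B\<^esub> k \<otimes>\<^bsub>B\<^esub> a) ` (?\<iota> ` {..<q} \<times> {..<r}) = carrier B"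
        using q r by (auto simp: carrier_B h_pow_nat mult_B)
    qed (auto simp: inj_on_def h_pow_nat mult_B)
    have mem_ker: "conj_by G (y [^] r) (x [^] i) \<in> kernel G B h" for i :: nat
      using x y h_pow_nat(2)[of r]
      by (simp add: kernel_def conj_by_def h.hom_nat_pow one_B[symmetric])
    have "T.transfer y = finprod T.N (\<lambda>a. conj_by G (y [^] r) (s a)) (?\<iota> ` {..<q})"
      using h_pow_nat(2)[of r] y by (intro T.transfer_eq_finprod_conj bij) (auto simp: carrier_B one_B r)
    also have "\<dots> = finprod T.N (\<lambda>i. conj_by G (y [^] r) (x [^] i)) {..<q}"
      using x y mem_ker
      by (subst T.N.finprod_reindex) (auto simp: inj_on_def s_def int_pow_int)
    also have "\<dots> = \<one>"
      using T.N.foldr_eq_finprod[of "\<lambda>i. conj_by G (y [^] r) (x [^] i)" q \<one>] mem_ker rel(2)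
      by (simp add: T.N.finprod_closed Pi_iff)
    finally show ?thesis .
  qed
  ultimately have trivial: "T.transfer g = \<one>" if "g \<in> carrier G" for g
    using T.transfer_trivial[OF gen _ _ that] x y by auto
  have vanish: "all_classes_vanish G (q * r)"
    unfolding all_classes_vanish_def conj_classes_def
    using T.transfer_in_set_power trivial by (auto simp: carrier_B card_cartesian_product)
  show ?thesis
    unfolding gen_exp_def
  proof (subst if_P)
    show "\<exists>k>0. all_classes_vanish G k"
      using vanish q r by (intro exI[of _ "q * r"]) simp
    show "(LEAST k. k > 0 \<and> all_classes_vanish G k) = q * r"
    proof (rule Least_equality)
      show "q * r \<le> k" if "k > 0 \<and> all_classes_vanish G k" for k
        using gen_exp_dvd[OF \<alpha>(1)[unfolded A_def] x \<alpha>(2)] that by (auto dest: dvd_imp_le)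
    qed (use vanish q r in simp)
  qed
qed

section \<open>Polynomial exponents and norm products\<close>

lemma (in monoid) foldr_mult_closed:
  "set xs \<subseteq> carrier G \<Longrightarrow> z \<in> carrier G \<Longrightarrow> foldr (\<otimes>) xs z \<in> carrier G"
  by (induction xs) auto

lemma (in monoid) foldr_mult_one:
  "set xs \<subseteq> carrier G \<Longrightarrow> z \<in> carrier G \<Longrightarrow> foldr (\<otimes>) xs z = foldr (\<otimes>) xs \<one> \<otimes> z"
  by (induction xs) (auto simp: m_assoc foldr_mult_closed)

lemma (in group_hom) hom_foldr_mult:
  "set xs \<subseteq> carrier G \<Longrightarrow> h (foldr (\<otimes>) xs \<one>) = foldr (\<otimes>\<^bsub>H\<^esub>) (map h xs) \<one>\<^bsub>H\<^esub>"
  by (induction xs) (auto simp: G.foldr_mult_closed)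

lemma (in group_hom) hom_conj_by:
  "u \<in> carrier G \<Longrightarrow> t \<in> carrier G \<Longrightarrow> h (conj_by G u t) = conj_by H (h u) (h t)"
  by (simp add: conj_by_def)

lemma (in group_hom) hom_poly_exp:
  assumes "g \<in> carrier G" "t \<in> carrier G"
  shows "h (poly_exp G g f t) = poly_exp H (h g) f (h t)"
  unfolding poly_exp_def using assms
  by (subst hom_foldr_mult)
    (auto simp: hom_conj_by hom_nat_pow hom_int_pow intro!: arg_cong[where f = "\<lambda>xs. foldr _ xs _"])

lemma coeff_Psi: "Polynomial.coeff (Psi k) i = (if i < k then 1 else 0)"
  by (auto simp: Psi_def coeff_sum)

text \<open>Stated with \<open>Suc\<close> because that is the length of the index list in
  \<open>poly_exp\<close>. For \<open>k = 0\<close> it fails: the zero polynomial has degree 0 by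
  convention.\<close>

lemma degree_Psi: "k > 0 \<Longrightarrow> Suc (Polynomial.degree (Psi k)) = k"
proof -
  assume k: "k > 0"
  have "Polynomial.degree (Psi k) \<le> k - 1"
    by (rule degree_le) (use k in \<open>auto simp: coeff_Psi\<close>)
  moreover have "k - 1 \<le> Polynomial.degree (Psi k)"
    by (rule le_degree) (use k in \<open>simp add: coeff_Psi\<close>)
  ultimately show ?thesis using k by simp
qed

lemma (in group) poly_exp_Psi:
  assumes "k > 0" "g \<in> carrier G"
  shows "poly_exp G g (Psi k) t = foldr (\<otimes>) (map (\<lambda>i. conj_by G g (t [^] i)) [0..<k]) \<one>"
  unfolding poly_exp_def degree_Psi[OF assms(1)]
  using assms by (intro arg_cong[where f = "\<lambda>xs. foldr (\<otimes>) xs \<one>"]) (simp add: coeff_Psi)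

lemma (in comm_group) conj_by_eq:
  "u \<in> carrier G \<Longrightarrow> t \<in> carrier G \<Longrightarrow> conj_by G u t = u"
  by (simp add: conj_by_def m_comm[of "inv t"] m_assoc)

text \<open>Conjugation is trivial here, so the last two relators of K(q, r) turn into
  \<open>q * r\<close>-th powers; this is why the target of \<open>\<alpha>\<close> and
  \<open>\<beta>\<close> is cyclic of order \<open>q * r\<close>.\<close>

lemma (in comm_group) poly_exp_Psi_comm:
  assumes "k > 0" "g \<in> carrier G" "t \<in> carrier G"
  shows "poly_exp G g (Psi k) t = g [^] k"
proof -
  have "foldr (\<otimes>) (map (\<lambda>i. conj_by G g (t [^] i)) [0..<k]) \<one> = foldr (\<otimes>) (map (\<lambda>_. g) [0..<k]) \<one>"
    using assms by (intro arg_cong[where f = "\<lambda>xs. foldr (\<otimes>) xs \<one>"]) (simp add: conj_by_eq)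
  also have "\<dots> = finprod G (\<lambda>_. g) {..<k}"
    using assms foldr_eq_finprod[of "\<lambda>_. g" k \<one>] by simp
  also have "\<dots> = g [^] k"
    using assms by (simp add: finprod_const)
  finally show ?thesis using assms by (simp add: poly_exp_Psi)
qed

text \<open>Conjugating the product of the conjugates of u by $t^0, \dots, t^{k-1}$ by t shifts it by one factor.\<close>

lemma (in group) conj_by_pow_eq:
  assumes u: "u \<in> carrier G" and t: "t \<in> carrier G"
    and rel: "foldr (\<otimes>) (map (\<lambda>i. conj_by G u (t [^] i)) [0..<k]) \<one> = \<one>"
  shows "conj_by G u (t [^] (k :: nat)) = u"
proof -
  define f where "f i = conj_by G u (t [^] (i :: nat))" for i
  define p where "p j = foldr (\<otimes>) (map f [0..<j]) \<one>" for j
  have f: "f i \<in> carrier G" for i using u t by (simp add: f_def)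
  have p: "p j \<in> carrier G" for j unfolding p_def by (rule foldr_mult_closed) (use f in auto)
  have pS: "p (Suc j) = p j \<otimes> f j" for j
    using foldr_mult_one[of "map f [0..<j]" "f j"] f by (auto simp: p_def)
  \<comment> \<open>Both sides are the ordered product of \<open>f 0\<close> up to
    \<open>f j\<close>. At \<open>j = k\<close> the partial product \<open>p k\<close> is 1 and
    \<open>u = f k\<close> remains.\<close>
  have "u \<otimes> conj_by G (p j) t = p j \<otimes> f j" for j
  proof (induction j)
    case 0
    then show ?case using u t by (simp add: p_def f_def)
  next
    case (Suc j)
    have "conj_by G (f j) t = f (Suc j)"
      using u t by (simp add: f_def conj_by_conj_by)
    then have "u \<otimes> conj_by G (p (Suc j)) t = (u \<otimes> conj_by G (p j) t) \<otimes> f (Suc j)"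
      using u t f p by (simp add: pS conj_by_mult m_assoc)
    then show ?case by (simp add: Suc pS)
  qed
  moreover have "p k = \<one>"
    using rel unfolding p_def f_def .
  ultimately have "u \<otimes> conj_by G \<one> t = \<one> \<otimes> f k"
    by metis
  then show ?thesis
    using u t f[of k] by (simp add: f_def)
qed

lemma (in group) conj_by_eq_imp_commute:
  assumes "u \<in> carrier G" "t \<in> carrier G" "conj_by G u t = u"
  shows "u \<otimes> t = t \<otimes> u"
proof -
  have "t \<otimes> conj_by G u t = u \<otimes> t"
    using assms(1,2) by (simp add: conj_by_def m_assoc[symmetric])
  then show ?thesis using assms(3) by simp
qed

section \<open>Two-generator metabelian groups\<close>

lemma (in group) commutator_derived:
  assumes "u \<in> carrier G" "v \<in> carrier G"
  shows "commutator G u v \<in> derived G (carrier G)"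
proof -
  \<comment> \<open>The set \<open>derived_set\<close> uses commutators of the form a b a^-1 b^-1,
    whence the inverted witnesses.\<close>
  have "commutator G u v \<in> derived_set G (carrier G)"
    using assms by (intro UN_I[of "inv u"] UN_I[of "inv v"]) (auto simp: commutator_def)
  then show ?thesis unfolding derived_def by (rule generate.incl)
qed

text \<open>A conjugate of \<open>z\<close> differs from \<open>z\<close> by a commutator: g z g^-1
  = [g^-1, z^-1] z.\<close>

lemma (in group) normal_of_derived_le:
  assumes "subgroup Z G" "derived G (carrier G) \<subseteq> Z"
  shows "Z \<lhd> G"
  unfolding normal_inv_iff
proof (intro conjI ballI)
  interpret Z: subgroup Z G by fact
  fix g z assume gz: "g \<in> carrier G" "z \<in> Z"
  then have z: "z \<in> carrier G" by simp
  have "commutator G (inv g) (inv z) \<otimes> z \<in> Z"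
    using assms(2) commutator_derived[of "inv g" "inv z"] gz z by (intro Z.m_closed) auto
  also have "commutator G (inv g) (inv z) \<otimes> z = g \<otimes> z \<otimes> inv g"
    using gz z by (simp add: commutator_def m_assoc)
  finally show "g \<otimes> z \<otimes> inv g \<in> Z" .
qed fact

lemma (in group) derived_commute:
  assumes triv: "derived G (derived G (carrier G)) = {\<one>}"
    and uv: "u \<in> derived G (carrier G)" "v \<in> derived G (carrier G)"
  shows "u \<otimes> v = v \<otimes> u"
proof -
  have c: "u \<in> carrier G" "v \<in> carrier G"
    using uv derived_in_carrier[of "carrier G"] by auto
  have "u \<otimes> v \<otimes> inv u \<otimes> inv v \<in> derived_set G (derived G (carrier G))"
    using uv by blast
  then have "u \<otimes> v \<otimes> inv u \<otimes> inv v = \<one>"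
    using triv generate.incl[of _ "derived_set G (derived G (carrier G))" G]
    unfolding derived_def[of G "derived G (carrier G)"] by blast
  then have "u \<otimes> v \<otimes> inv (v \<otimes> u) = \<one>"
    using c by (simp add: inv_mult_group m_assoc)
  then show ?thesis
    using c by (metis inv_equality inv_closed inv_inv m_closed)
qed

text \<open>The elements of an abelian derived subgroup that commute with u form a normal subgroup.\<close>

lemma (in group) commute_derived:
  assumes triv: "derived G (derived G (carrier G)) = {\<one>}"
    and gen: "generate G {x, y} = carrier G" and xy: "x \<in> carrier G" "y \<in> carrier G"
    and u: "u \<in> carrier G" and comm: "commutator G x y \<otimes> u = u \<otimes> commutator G x y"
    and d: "d \<in> derived G (carrier G)"
  shows "d \<otimes> u = u \<otimes> d"
proof -
  let ?D = "derived G (carrier G)"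
  interpret D: normal ?D G
    by (rule normal_of_derived_le) (auto intro: derived_is_subgroup)
  define Z where "Z = {d \<in> ?D. conj_by G d u = d}"
  have conj: "conj_by G d u = d \<longleftrightarrow> d \<otimes> u = u \<otimes> d" if "d \<in> carrier G" for d
  proof
    assume "d \<otimes> u = u \<otimes> d"
    then show "conj_by G d u = d"
      using that u by (simp add: conj_by_def m_assoc) (simp add: m_assoc[symmetric])
  qed (use that u conj_by_eq_imp_commute in blast)
  have "subgroup Z G"
  proof (rule subgroupI)
    show "Z \<subseteq> carrier G" by (auto simp: Z_def)
    have "\<one> \<in> Z" using D.one_closed u by (simp add: Z_def)
    then show "Z \<noteq> {}" by blast
    show "inv a \<in> Z" if "a \<in> Z" for a
      using that u by (auto simp: Z_def conj_by_inv)
    show "a \<otimes> b \<in> Z" if "a \<in> Z" "b \<in> Z" for a b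
      using that u by (auto simp: Z_def conj_by_mult)
  qed
  have "Z \<lhd> G"
    unfolding normal_inv_iff
  proof (intro conjI ballI)
    fix g d assume g: "g \<in> carrier G" and "d \<in> Z"
    then have d: "d \<in> ?D" "d \<in> carrier G" "conj_by G d u = d"
      by (auto simp: Z_def)
    \<comment> \<open>Conjugations by \<open>u\<close> and \<open>inv g\<close> commute up to
      \<open>e\<close>. As \<open>e\<close> lies in the abelian derived subgroup, it acts trivially
      on \<open>d\<close>.\<close>
    define e where "e = commutator G u g"
    have e: "e \<in> ?D" "e \<in> carrier G"
      using commutator_derived[OF u g] u g by (auto simp: e_def)
    have ue: "inv g \<otimes> u = u \<otimes> e \<otimes> inv g"
      using u g by (simp add: e_def commutator_def m_assoc) (simp add: m_assoc[symmetric])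
    have "conj_by G (g \<otimes> d \<otimes> inv g) u = conj_by G d (inv g \<otimes> u)"
      using g d u conj_by_conj_by[of d "inv g" u] by (simp add: conj_by_def[of G d "inv g"])
    also have "\<dots> = conj_by G (conj_by G (conj_by G d u) e) (inv g)"
      using g d(2) u e by (simp add: conj_by_conj_by ue)
    also have "conj_by G (conj_by G d u) e = d"
      using d e derived_commute[OF triv d(1) e(1)] by (simp add: conj_by_def m_assoc) (simp add: m_assoc[symmetric])
    also have "conj_by G d (inv g) = g \<otimes> d \<otimes> inv g"
      using g d by (simp add: conj_by_def)
    finally show "g \<otimes> d \<otimes> inv g \<in> Z"
      using D.inv_op_closed2[OF g d(1)] by (simp add: Z_def)
  qed fact
  \<comment> \<open>\<open>Z\<close> contains the commutator of the generators, so its quotient is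
    abelian, and the derived subgroup is the least normal subgroup with that property.\<close>
  moreover from this have "comm_group (G Mod Z)"
    using xy commutator_derived[OF xy] comm conj
    by (intro comm_group_Mod_commutator[OF _ gen xy]) (auto simp: Z_def)
  ultimately have "?D \<subseteq> Z" by (rule derived_minimal)
  then show ?thesis using d conj by (auto simp: Z_def)
qed

section \<open>The groups K(q, r)\<close>

lemma (in group_hom) FactGroup_hom_ex:
  assumes "N \<lhd> G" "N \<subseteq> kernel G H h"
  shows "\<exists>g \<in> hom (G Mod N) H. \<forall>u \<in> carrier G. g (N #> u) = h u"
proof (rule FactGroup_universal_kernel[OF assms])
  fix g assume "g \<in> hom (G Mod N) H" "\<And>u. u \<in> carrier G \<Longrightarrow> g (N #> u) = h u"
  then show ?thesis by blast
qed

context group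
begin

context
  fixes R assumes R: "R \<subseteq> carrier G"
begin

text \<open>Von Dyck's theorem: the kernel of \<open>h\<close> is one of the normal subgroups whose
  intersection is the normal closure.\<close>

lemma normal_closure_hom:
  assumes "group H" and h: "h \<in> hom G H" and rel: "\<forall>u \<in> R. h u = \<one>\<^bsub>H\<^esub>"
  shows "\<exists>g \<in> hom (G Mod normal_closure G R) H.
    \<forall>u \<in> carrier G. g (normal_closure G R #> u) = h u"
proof -
  interpret h: group_hom G H h
    using assms by (simp add: group_hom_def group_hom_axioms_def is_group)
  have "normal_closure G R \<subseteq> kernel G H h"
    unfolding normal_closure_def using h.normal_kernel R rel by (intro Inter_lower) (auto simp: kernel_def)
  then show ?thesis
    by (rule h.FactGroup_hom_ex[OF normal_normal_closure[OF R]])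
qed

lemma group_hom_normal_closure:
  "group_hom G (G Mod normal_closure G R) (\<lambda>u. normal_closure G R #> u)"
  by (rule normal.group_hom_Mod[OF normal_normal_closure[OF R]])

lemma normal_closure_relator:
  assumes "u \<in> R"
  shows "normal_closure G R #> u = \<one>\<^bsub>G Mod normal_closure G R\<^esub>"
proof -
  have "u \<in> normal_closure G R"
    using assms by (auto simp: normal_closure_def)
  then show ?thesis
    using normal.Mod_eq_one_iff[OF normal_normal_closure[OF R]] assms R by auto
qed

end

end

section \<open>Generators of, and maps out of, the free and free metabelian groups\<close>

lemma (in group_hom) generate_two_image:
  assumes "generate G {x, y} = carrier G" "x \<in> carrier G" "y \<in> carrier G" "h ` carrier G = carrier H"
  shows "generate H {h x, h y} = carrier H"
  using generate_img[of "{x, y}"] assms by simp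

lemma free_group_generate_two:
  "generate free_group {free_gen Gen_x, free_gen Gen_y} = carrier free_group"
proof -
  have "range free_gen = {free_gen Gen_x, free_gen Gen_y}"
  proof
    show "range free_gen \<subseteq> {free_gen Gen_x, free_gen Gen_y}"
    proof (rule image_subsetI)
      fix a show "free_gen a \<in> {free_gen Gen_x, free_gen Gen_y}" by (cases a) simp_all
    qed
  qed blast
  then show ?thesis
    using free_group_generated[where ?'a = two_gens] by (simp only:)
qed

lemma free_group_hom_two:
  assumes "group H" "a \<in> carrier H" "b \<in> carrier H"
  obtains h where "h \<in> hom free_group H" "h (free_gen Gen_x) = a" "h (free_gen Gen_y) = b"
proof -
  define f where "f g = (case g of Gen_x \<Rightarrow> a | Gen_y \<Rightarrow> b)" for g
  have "f g \<in> carrier H" for g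
    using assms(2,3) by (simp add: f_def split: two_gens.split)
  then obtain h where "h \<in> hom free_group H" "\<forall>g. h (free_gen g) = f g"
    using free_group_universal[OF assms(1)] by blast
  then show thesis
    using that[of h] by (simp add: f_def)
qed

abbreviation "mx \<equiv> free_metabelian_gen Gen_x"
abbreviation "my \<equiv> free_metabelian_gen Gen_y"

lemma normal_second_derived:
  "derived free_group (derived free_group (carrier free_group)) \<lhd> free_group"
proof -
  interpret F: group free_group by (rule group_free_group)
  have "derived free_group (carrier free_group) \<lhd> free_group"
    by (rule F.normal_of_derived_le) (auto intro: F.derived_is_subgroup)
  then show ?thesis by (rule F.derived_is_normal)
qed

abbreviation "metabelian_proj \<equiv>
  \<lambda>w. derived free_group (derived free_group (carrier free_group)) #>\<^bsub>free_group\<^esub> w"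

lemma group_hom_metabelian_proj: "group_hom free_group free_metabelian metabelian_proj"
  unfolding free_metabelian_def by (rule normal.group_hom_Mod[OF normal_second_derived])

lemma metabelian_proj_surj: "metabelian_proj ` carrier free_group = carrier free_metabelian"
  by (auto simp: free_metabelian_def carrier_FactGroup)

lemma free_metabelian_gen_closed: "free_metabelian_gen a \<in> carrier free_metabelian"
  unfolding free_metabelian_gen_def
  by (rule group_hom.hom_closed[OF group_hom_metabelian_proj free_gen_in_carrier])

lemma free_metabelian_generate_two: "generate free_metabelian {mx, my} = carrier free_metabelian"
  using group_hom.generate_two_image[OF group_hom_metabelian_proj free_group_generate_two
      free_gen_in_carrier free_gen_in_carrier metabelian_proj_surj]
  by (simp add: free_metabelian_gen_def)

lemma free_metabelian_metabelian:
  "derived free_metabelian (derived free_metabelian (carrier free_metabelian)) = {\<one>\<^bsub>free_metabelian\<^esub>}"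
proof -
  let ?F = "free_group :: ('a \<times> bool) list monoid"
  let ?D = "derived ?F (carrier ?F)"
  interpret F: group ?F by (rule group_free_group)
  interpret p: group_hom ?F free_metabelian metabelian_proj by (rule group_hom_metabelian_proj)
  have D: "?D \<subseteq> carrier ?F" "derived ?F ?D \<subseteq> carrier ?F"
    by (simp_all add: F.derived_in_carrier)
  have "derived free_metabelian (derived free_metabelian (carrier free_metabelian))
      = metabelian_proj ` derived ?F ?D"
    by (simp add: metabelian_proj_surj[symmetric] p.derived_img D)
  also have "\<dots> = (\<lambda>_. \<one>\<^bsub>free_metabelian\<^esub>) ` derived ?F ?D"
  proof (rule image_cong)
    fix w assume "w \<in> derived ?F ?D"
    then show "metabelian_proj w = \<one>\<^bsub>free_metabelian\<^esub>"
      using normal.Mod_eq_one_iff[OF normal_second_derived subsetD[OF D(2)]]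
      by (simp add: free_metabelian_def)
  qed simp
  also have "\<dots> = {\<one>\<^bsub>free_metabelian\<^esub>}"
    using subgroup.one_closed[OF F.derived_is_subgroup[OF D(1)]] by (rule image_constant)
  finally show ?thesis .
qed

text \<open>Abelian targets suffice for the coordinates on the abelianization. For these the map
  from the free group kills the derived subgroup, which contains the second derived
  subgroup.\<close>

lemma free_metabelian_hom_two:
  assumes "comm_group H" "a \<in> carrier H" "b \<in> carrier H"
  obtains h where "h \<in> hom free_metabelian H" "h mx = a" "h my = b"
proof -
  interpret F: group free_group by (rule group_free_group)
  interpret H: comm_group H by fact
  obtain f where f: "f \<in> hom free_group H" "f (free_gen Gen_x) = a" "f (free_gen Gen_y) = b"
    by (rule free_group_hom_two[OF H.is_group assms(2,3)])
  interpret f: group_hom free_group H f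
    using f(1) by (simp add: group_hom_def group_hom_axioms_def F.is_group H.is_group)
  have "f ` derived free_group (carrier free_group) = derived H (f ` carrier free_group)"
    by (simp add: f.derived_img)
  also have "\<dots> = {\<one>\<^bsub>H\<^esub>}"
    using F.one_closed by (intro H.derived_eq_singleton) auto
  finally have "derived free_group (carrier free_group) \<subseteq> kernel free_group H f"
    using F.derived_in_carrier[of "carrier free_group"] by (auto simp: kernel_def)
  moreover have "derived free_group (derived free_group (carrier free_group))
      \<subseteq> derived free_group (carrier free_group)"
    by (rule F.derived_incl) (auto intro: F.derived_is_subgroup)
  ultimately have "derived free_group (derived free_group (carrier free_group))
      \<subseteq> kernel free_group H f" by (rule subset_trans[rotated])
  from f.FactGroup_hom_ex[OF normal_second_derived this] obtain h
    where "h \<in> hom (free_group Mod derived free_group (derived free_group (carrier free_group))) H"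
      "\<forall>w \<in> carrier free_group. h (metabelian_proj w) = f w"
    by (elim bexE)
  then show thesis
    using that[of h] f(2,3)
    by (simp add: free_gen_in_carrier free_metabelian_def free_metabelian_gen_def)
qed

lemma gen_exp_K:
  assumes q: "q > 0" and r: "r > 0"
  shows "gen_exp (K q r) = q * r"
proof -
  let ?M = "free_metabelian :: (two_gens \<times> bool) list set monoid"
  let ?R = "K_relators ?M mx my q r"
  interpret M: group ?M by (rule group_free_metabelian)
  note gens = free_metabelian_gen_closed[of Gen_x] free_metabelian_gen_closed[of Gen_y]
  have poly: "poly_exp ?M u f t \<in> carrier ?M" if "u \<in> carrier ?M" "t \<in> carrier ?M" for u t f
    unfolding poly_exp_def by (rule M.foldr_mult_closed) (use that in auto)
  have R: "?R \<subseteq> carrier ?M"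
    using gens poly by (auto simp: K_relators_def)
  define \<pi> where "\<pi> u = normal_closure ?M ?R #>\<^bsub>?M\<^esub> u" for u
  interpret \<pi>: group_hom ?M "K q r" \<pi>
    unfolding \<pi>_def K_def by (rule M.group_hom_normal_closure[OF R])
  have surj: "\<pi> ` carrier ?M = carrier (K q r)"
    by (auto simp: \<pi>_def K_def carrier_FactGroup)
  define x y where "x = \<pi> mx" and "y = \<pi> my"
  have xy: "x \<in> carrier (K q r)" "y \<in> carrier (K q r)"
    using gens by (auto simp: x_def y_def)
  have gen: "generate (K q r) {x, y} = carrier (K q r)"
    unfolding x_def y_def
    by (rule \<pi>.generate_two_image[OF free_metabelian_generate_two gens surj])
  let ?G = "K q r"
  let ?D = "derived ?G (carrier ?G)"
  have "\<pi> ` derived ?M (derived ?M (carrier ?M)) = derived ?G ?D"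
    using M.derived_in_carrier[of "carrier ?M"]
    by (simp add: surj[symmetric] \<pi>.derived_img)
  then have metab: "derived ?G ?D = {\<one>\<^bsub>?G\<^esub>}"
    by (simp add: free_metabelian_metabelian)
  have rel: "\<pi> u = \<one>\<^bsub>?G\<^esub>" if "u \<in> ?R" for u
    using M.normal_closure_relator[OF R that] by (simp add: \<pi>_def K_def)
  have comm: "commutator ?G (commutator ?G x y) (x [^]\<^bsub>?G\<^esub> q) = \<one>\<^bsub>?G\<^esub>"
    "commutator ?G (commutator ?G x y) (y [^]\<^bsub>?G\<^esub> r) = \<one>\<^bsub>?G\<^esub>"
    using rel[of "commutator ?M (commutator ?M mx my) (mx [^]\<^bsub>?M\<^esub> q)"]
      rel[of "commutator ?M (commutator ?M mx my) (my [^]\<^bsub>?M\<^esub> r)"] gens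
    by (simp_all add: K_relators_def x_def y_def \<pi>.hom_commutator \<pi>.hom_nat_pow)
  have "poly_exp ?G (x [^]\<^bsub>?G\<^esub> q) (Psi r) y = \<one>\<^bsub>?G\<^esub>"
    "poly_exp ?G (y [^]\<^bsub>?G\<^esub> r) (Psi q) x = \<one>\<^bsub>?G\<^esub>"
    using rel[of "poly_exp ?M (mx [^]\<^bsub>?M\<^esub> q) (Psi r) my"]
      rel[of "poly_exp ?M (my [^]\<^bsub>?M\<^esub> r) (Psi q) mx"] gens
    by (simp_all add: K_relators_def x_def y_def \<pi>.hom_poly_exp \<pi>.hom_nat_pow)
  then have norm:
    "foldr (\<otimes>\<^bsub>?G\<^esub>) (map (\<lambda>j. conj_by ?G (x [^]\<^bsub>?G\<^esub> q) (y [^]\<^bsub>?G\<^esub> j)) [0..<r]) \<one>\<^bsub>?G\<^esub> = \<one>\<^bsub>?G\<^esub>"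
    "foldr (\<otimes>\<^bsub>?G\<^esub>) (map (\<lambda>i. conj_by ?G (y [^]\<^bsub>?G\<^esub> r) (x [^]\<^bsub>?G\<^esub> i)) [0..<q]) \<one>\<^bsub>?G\<^esub> = \<one>\<^bsub>?G\<^esub>"
    using \<pi>.H.poly_exp_Psi q r xy by simp_all
  \<comment> \<open>Including the whole derived subgroup makes the generated subgroup normal at
    once; it remains to see that the listed elements commute pairwise.\<close>
  define S where "S = ?D \<union> {x [^]\<^bsub>?G\<^esub> q, y [^]\<^bsub>?G\<^esub> r}"
  have S: "S \<subseteq> carrier ?G"
    using xy \<pi>.H.derived_in_carrier[of "carrier ?G"] by (auto simp: S_def)
  have D_comm: "d \<otimes>\<^bsub>?G\<^esub> x [^]\<^bsub>?G\<^esub> q = x [^]\<^bsub>?G\<^esub> q \<otimes>\<^bsub>?G\<^esub> d"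
    "d \<otimes>\<^bsub>?G\<^esub> y [^]\<^bsub>?G\<^esub> r = y [^]\<^bsub>?G\<^esub> r \<otimes>\<^bsub>?G\<^esub> d" if "d \<in> ?D" for d
    using \<pi>.H.commute_derived[OF metab gen xy _ _ that] comm xy
    by (simp_all add: \<pi>.H.commutator_eq_one_iff)
  \<comment> \<open>By the first norm relation \<open>y [^] r\<close> centralizes
    \<open>x [^] q\<close>.\<close>
  have "x [^]\<^bsub>?G\<^esub> q \<otimes>\<^bsub>?G\<^esub> y [^]\<^bsub>?G\<^esub> r = y [^]\<^bsub>?G\<^esub> r \<otimes>\<^bsub>?G\<^esub> x [^]\<^bsub>?G\<^esub> q"
    using xy by (intro \<pi>.H.conj_by_eq_imp_commute \<pi>.H.conj_by_pow_eq norm(1)) simp_all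
  then have S_comm: "u \<otimes>\<^bsub>?G\<^esub> v = v \<otimes>\<^bsub>?G\<^esub> u" if "u \<in> S" "v \<in> S" for u v
    using that \<pi>.H.derived_commute[OF metab, of u v] D_comm[of u] D_comm[of v]
    unfolding S_def by (elim UnE insertE emptyE) simp_all
  have S_le: "S \<subseteq> generate ?G S"
    by (auto intro: generate.incl)
  have Z: "generate ?G S \<lhd> ?G"
    using S S_le by (intro \<pi>.H.normal_of_derived_le \<pi>.H.generate_is_subgroup) (auto simp: S_def)
  let ?A = "integer_mod_group (q * r)"
  \<comment> \<open>Any two values extend to K(q, r): commutators vanish in the abelian target, and
    the norm relators become \<open>q * r\<close>-th powers, which vanish in a cyclic group of that
    order.\<close>
  have hom: "\<exists>\<alpha> \<in> hom ?G ?A. \<alpha> x = a \<and> \<alpha> y = b" if ab: "a \<in> carrier ?A" "b \<in> carrier ?A" for a b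
  proof -
    interpret A: comm_group ?A by simp
    obtain f where f: "f \<in> hom ?M ?A" "f mx = a" "f my = b"
      by (rule free_metabelian_hom_two[OF A.comm_group_axioms ab])
    interpret f: group_hom ?M ?A f
      using f(1) by (simp add: group_hom_def group_hom_axioms_def M.is_group)
    have pow: "(c [^]\<^bsub>?A\<^esub> k) [^]\<^bsub>?A\<^esub> l = \<one>\<^bsub>?A\<^esub>" if "c \<in> carrier ?A" "k * l = q * r" for c k l
      unfolding A.nat_pow_pow[OF that(1)] that(2) by simp
    have c: "f (commutator ?M u v) = \<one>\<^bsub>?A\<^esub>" if "u \<in> carrier ?M" "v \<in> carrier ?M" for u v
      using that A.m_comm[of "f u" "f v"] A.commutator_eq_one_iff[of "f u" "f v"]
      by (simp only: f.hom_commutator f.hom_closed)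
    have "\<forall>u \<in> ?R. f u = \<one>\<^bsub>?A\<^esub>"
    proof -
      have "f (poly_exp ?M (mx [^]\<^bsub>?M\<^esub> q) (Psi r) my) = \<one>\<^bsub>?A\<^esub>"
        "f (poly_exp ?M (my [^]\<^bsub>?M\<^esub> r) (Psi q) mx) = \<one>\<^bsub>?A\<^esub>"
        using pow[OF ab(1), of q r] pow[OF ab(2), of r q]
        by (simp_all only: f.hom_poly_exp f.hom_nat_pow gens M.nat_pow_closed f(2,3)
            A.poly_exp_Psi_comm[OF r A.nat_pow_closed[OF ab(1)] ab(2)]
            A.poly_exp_Psi_comm[OF q A.nat_pow_closed[OF ab(2)] ab(1)] mult.commute[of r q])
      moreover have "f (commutator ?M (commutator ?M mx my) (mx [^]\<^bsub>?M\<^esub> q)) = \<one>\<^bsub>?A\<^esub>"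
        "f (commutator ?M (commutator ?M mx my) (my [^]\<^bsub>?M\<^esub> r)) = \<one>\<^bsub>?A\<^esub>"
        using gens by (simp_all only: c M.commutator_closed M.nat_pow_closed)
      ultimately show ?thesis
        unfolding K_relators_def by blast
    qed
    from M.normal_closure_hom[OF R A.is_group f(1) this] obtain g
      where "g \<in> hom (?M Mod normal_closure ?M ?R) ?A"
        "\<forall>u \<in> carrier ?M. g (normal_closure ?M ?R #>\<^bsub>?M\<^esub> u) = f u"
      by (elim bexE)
    then have "g \<in> hom ?G ?A" "g x = a" "g y = b"
      using f(2,3) gens by (simp_all add: K_def x_def y_def \<pi>_def)
    then show ?thesis by blast
  qed
  \<comment> \<open>The reduction matters only for \<open>q * r = 1\<close>, when the group is
    trivial and its sole element is 0.\<close>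
  have one: "1 mod int (q * r) \<in> carrier ?A"
    using q r by (simp add: carrier_integer_mod_group)
  obtain \<alpha> where \<alpha>: "\<alpha> \<in> hom ?G ?A" "\<alpha> x = 1 mod int (q * r)" "\<alpha> y = 0"
    using hom[OF one integer_mod_group_0] by blast
  obtain \<beta> where \<beta>: "\<beta> \<in> hom ?G ?A" "\<beta> x = 0" "\<beta> y = 1 mod int (q * r)"
    using hom[OF integer_mod_group_0 one] by blast
  have mem: "commutator ?G x y \<in> generate ?G S" "x [^]\<^bsub>?G\<^esub> q \<in> generate ?G S"
    "y [^]\<^bsub>?G\<^esub> r \<in> generate ?G S"
    by (rule subsetD[OF S_le], simp add: S_def \<pi>.H.commutator_derived[OF xy])+
  show ?thesis
    by (rule \<pi>.H.gen_exp_eq[OF q r gen xy Z \<pi>.H.generate_commute[OF S S_comm] mem norm \<alpha> \<beta>])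
qed

section \<open>The Promislow group\<close>

text \<open>Conjugation by each generator fixes or inverts each \<open>s\<close>, and this passes to
  products and inverses, hence to all of \<open>G\<close>. The lattice of the Promislow group is of
  this kind.\<close>

lemma (in group) generate_normalI:
  assumes S: "S \<subseteq> carrier G" and X: "X \<subseteq> carrier G" and gen: "generate G X = carrier G"
    and inverted: "\<And>s x. s \<in> S \<Longrightarrow> x \<in> X \<Longrightarrow> conj_by G s x \<in> {s, inv s}"
  shows "generate G S \<lhd> G"
proof -
  have conj: "conj_by G s g \<in> {s, inv s}" if s: "s \<in> S" and g: "g \<in> carrier G" for s g
  proof -
    have sc: "s \<in> carrier G" using s S by auto
    have "g \<in> generate G X" using g gen by simp
    then show ?thesis
    proof (induction rule: generate.induct)
      \<comment> \<open>If conjugation by \<open>x\<close> fixes or inverts \<open>s\<close>, so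
        does the inverse conjugation.\<close>
      case (inv x)
      then have x: "x \<in> carrier G" using X by auto
      have "conj_by G (conj_by G s x) (inv x) = s"
        using sc x by (simp add: conj_by_conj_by)
      moreover have "conj_by G s x = s \<or> conj_by G s x = inv s"
        using inverted[OF s inv] by simp
      ultimately have "conj_by G s (inv x) = s \<or> inv conj_by G s (inv x) = s"
        using sc x conj_by_inv[of s "inv x"] by auto
      moreover have "inv (inv conj_by G s (inv x)) = conj_by G s (inv x)"
        using sc x by simp
      ultimately show ?case by (elim disjE) simp_all
    next
      case (eng g g')
      then have g: "g \<in> carrier G" "g' \<in> carrier G" using gen by simp_all
      have "conj_by G s (g \<otimes> g') = conj_by G (conj_by G s g) g'"
        using sc g by (simp add: conj_by_conj_by)
      then show ?case
        using eng sc g by (auto simp: conj_by_inv)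
    qed (use sc s inverted in auto)
  qed
  have gS: "generate G S \<subseteq> carrier G" using S by (rule generate_incl)
  show ?thesis
    unfolding normal_inv_iff
  proof (intro conjI ballI)
    show "subgroup (generate G S) G" using S by (rule generate_is_subgroup)
    fix g u assume g: "g \<in> carrier G" and u: "u \<in> generate G S"
    interpret c: group_hom G G "\<lambda>u. conj_by G u (inv g)"
      using g by (simp add: conj_by_group_hom)
    have "conj_by G u (inv g) \<in> generate G ((\<lambda>u. conj_by G u (inv g)) ` S)"
      using c.generate_img[OF S] u by blast
    also have "(\<lambda>u. conj_by G u (inv g)) ` S \<subseteq> generate G S"
    proof (rule image_subsetI)
      fix s assume "s \<in> S"
      then show "conj_by G s (inv g) \<in> generate G S"
        using conj[of s "inv g"] g generate.incl[of s S G] generate.inv[of s S G] by auto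
    qed
    then have "generate G ((\<lambda>u. conj_by G u (inv g)) ` S) \<subseteq> generate G S"
      by (rule generate_subgroup_incl[OF _ generate_is_subgroup[OF S]])
    finally show "g \<otimes> u \<otimes> inv g \<in> generate G S"
      using g u gS by (simp add: conj_by_def)
  qed
qed

lemma (in group) pow_2: "u \<in> carrier G \<Longrightarrow> u [^] (2 :: nat) = u \<otimes> u"
  by (simp add: numeral_2_eq_2)

text \<open>The squares of x, y and xy generate the translation lattice of the Promislow group.\<close>

lemma (in group) promislow_lattice:
  assumes x: "x \<in> carrier G" and y: "y \<in> carrier G"
    and a: "conj_by G (x \<otimes> x) y = inv (x \<otimes> x)" and b: "conj_by G (y \<otimes> y) x = inv (y \<otimes> y)"
  defines "z \<equiv> x \<otimes> y \<otimes> (x \<otimes> y)"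
  shows "conj_by G z x = inv z" and "conj_by G z y = inv z"
    and "commutator G x y = inv (x \<otimes> x) \<otimes> (y \<otimes> y \<otimes> z)"
    and "u \<in> {x \<otimes> x, y \<otimes> y, z} \<Longrightarrow> v \<in> {x \<otimes> x, y \<otimes> y, z} \<Longrightarrow> u \<otimes> v = v \<otimes> u"
proof -
  have c: "inv x \<otimes> (x \<otimes> w) = w" "x \<otimes> (inv x \<otimes> w) = w"
    "inv y \<otimes> (y \<otimes> w) = w" "y \<otimes> (inv y \<otimes> w) = w" if "w \<in> carrier G" for w
    using that x y by (simp_all add: m_assoc[symmetric])
  have "x \<otimes> conj_by G (y \<otimes> y) x = y \<otimes> (y \<otimes> x)"
    using x y by (simp add: conj_by_def m_assoc c)
  then have "y \<otimes> (y \<otimes> x) = x \<otimes> (inv y \<otimes> inv y)"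
    using x y by (simp add: b inv_mult_group)
  \<comment> \<open>The tail \<open>w\<close> turns the relation into a rewrite rule for
    right-associated words; with \<open>yxx\<close> below it moves \<open>y\<close> to the right
    past \<open>x\<close> and reduces the words for \<open>z\<close>.\<close>
  then have yyx: "y \<otimes> (y \<otimes> (x \<otimes> w)) = x \<otimes> (inv y \<otimes> (inv y \<otimes> w))" if "w \<in> carrier G" for w
    using that x y by (metis inv_closed m_assoc m_closed)
  have "conj_by G (inv (x \<otimes> x)) y = x \<otimes> x"
    using x y a by (simp add: conj_by_inv)
  moreover have "y \<otimes> conj_by G (inv (x \<otimes> x)) y = inv x \<otimes> (inv x \<otimes> y)"
    using x y by (simp add: conj_by_def m_assoc c inv_mult_group)
  ultimately have "y \<otimes> (x \<otimes> x) = inv x \<otimes> (inv x \<otimes> y)"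
    by simp
  then have yxx: "y \<otimes> (x \<otimes> (x \<otimes> w)) = inv x \<otimes> (inv x \<otimes> (y \<otimes> w))" if "w \<in> carrier G" for w
    using that x y by (metis inv_closed m_assoc m_closed)
  have z: "z \<in> carrier G" using x y by (simp add: z_def)
  have "conj_by G z x \<otimes> z = \<one>"
    using x y by (simp add: z_def conj_by_def m_assoc c yyx yxx)
  then show zx: "conj_by G z x = inv z"
    using x z inv_equality by simp
  have "conj_by G z y \<otimes> z = \<one>"
    using x y by (simp add: z_def conj_by_def m_assoc c yyx yxx)
  then show zy: "conj_by G z y = inv z"
    using y z inv_equality by simp
  show "commutator G x y = inv (x \<otimes> x) \<otimes> (y \<otimes> y \<otimes> z)"
    using x y by (simp add: z_def commutator_def m_assoc c yyx inv_mult_group)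
  have ax: "conj_by G (x \<otimes> x) x = x \<otimes> x" and yy: "conj_by G (y \<otimes> y) y = y \<otimes> y"
    using x y by (simp_all add: conj_by_def m_assoc c)
  \<comment> \<open>An element that inverts \<open>u\<close> has a square centralizing
    \<open>u\<close>. All three lattice elements are squares: \<open>x\<close> inverts the square of
    \<open>y\<close>, and \<open>x \<otimes> y\<close> inverts the squares of \<open>x\<close> and
    of \<open>y\<close>.\<close>
  have two: "conj_by G u (g \<otimes> g) = u"
    if "u \<in> carrier G" "g \<in> carrier G" "conj_by G u g = inv u" for u g
    using that conj_by_conj_by[of u g g] by (simp add: conj_by_inv)
  have xy: "conj_by G (x \<otimes> x) (x \<otimes> y) = inv (x \<otimes> x)" "conj_by G (y \<otimes> y) (x \<otimes> y) = inv (y \<otimes> y)"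
    using x y conj_by_conj_by[of "x \<otimes> x" x y] conj_by_conj_by[of "y \<otimes> y" x y]
    by (simp_all add: ax yy a b conj_by_inv)
  have "y \<otimes> y \<otimes> (x \<otimes> x) = x \<otimes> x \<otimes> (y \<otimes> y)"
    using x y b by (intro conj_by_eq_imp_commute two) simp_all
  moreover have "x \<otimes> x \<otimes> z = z \<otimes> (x \<otimes> x)" "y \<otimes> y \<otimes> z = z \<otimes> (y \<otimes> y)"
    unfolding z_def using x y xy by (intro conj_by_eq_imp_commute two; simp)+
  ultimately show "u \<otimes> v = v \<otimes> u" if "u \<in> {x \<otimes> x, y \<otimes> y, z}" "v \<in> {x \<otimes> x, y \<otimes> y, z}"
    using that by (elim insertE emptyE) simp_all
qed

lemma gen_exp_Promislow: "gen_exp Promislow = 4"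
proof -
  let ?F = "free_group :: (two_gens \<times> bool) list monoid"
  let ?fx = "free_gen Gen_x" and ?fy = "free_gen Gen_y"
  let ?R = "P_relators ?F ?fx ?fy"
  interpret F: group ?F by (rule group_free_group)
  have R: "?R \<subseteq> carrier ?F"
    by (auto simp: P_relators_def free_gen_in_carrier)
  define \<pi> where "\<pi> u = normal_closure ?F ?R #>\<^bsub>?F\<^esub> u" for u
  interpret \<pi>: group_hom ?F Promislow \<pi>
    unfolding \<pi>_def Promislow_def by (rule F.group_hom_normal_closure[OF R])
  have surj: "\<pi> ` carrier ?F = carrier Promislow"
    by (auto simp: \<pi>_def Promislow_def carrier_FactGroup)
  define x y where "x = \<pi> ?fx" and "y = \<pi> ?fy"
  have xy: "x \<in> carrier Promislow" "y \<in> carrier Promislow"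
    by (simp_all add: x_def y_def free_gen_in_carrier)
  have gen: "generate Promislow {x, y} = carrier Promislow"
    unfolding x_def y_def
    by (rule \<pi>.generate_two_image[OF free_group_generate_two free_gen_in_carrier free_gen_in_carrier surj])
  have pow: "u [^]\<^bsub>G\<^esub> (2 :: int) = u \<otimes>\<^bsub>G\<^esub> u" "u [^]\<^bsub>G\<^esub> (-2 :: int) = inv\<^bsub>G\<^esub> (u \<otimes>\<^bsub>G\<^esub> u)"
    if "group G" "u \<in> carrier G" for u and G :: "('b, 'c) monoid_scheme"
    using that group.pow_2[OF that] group.int_pow_neg[OF that, of 2] int_pow_int[of G u 2]
    by simp_all
  let ?P = Promislow
  have rel: "\<pi> u = \<one>\<^bsub>?P\<^esub>" if "u \<in> ?R" for u
    using F.normal_closure_relator[OF R that] by (simp add: \<pi>_def Promislow_def)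
  have ab: "conj_by ?P (x \<otimes>\<^bsub>?P\<^esub> x) y = inv\<^bsub>?P\<^esub> (x \<otimes>\<^bsub>?P\<^esub> x)"
    "conj_by ?P (y \<otimes>\<^bsub>?P\<^esub> y) x = inv\<^bsub>?P\<^esub> (y \<otimes>\<^bsub>?P\<^esub> y)"
  proof -
    have *: "conj_by ?P (\<pi> u \<otimes>\<^bsub>?P\<^esub> \<pi> u) (\<pi> t) = inv\<^bsub>?P\<^esub> (\<pi> u \<otimes>\<^bsub>?P\<^esub> \<pi> u)"
      if "u \<in> carrier ?F" "t \<in> carrier ?F"
        "conj_by ?F (u [^]\<^bsub>?F\<^esub> (2::int)) t \<otimes>\<^bsub>?F\<^esub> inv\<^bsub>?F\<^esub> (u [^]\<^bsub>?F\<^esub> (-2::int)) \<in> ?R" for u t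
    proof -
      have "\<pi> (conj_by ?F (u \<otimes>\<^bsub>?F\<^esub> u) t \<otimes>\<^bsub>?F\<^esub> (u \<otimes>\<^bsub>?F\<^esub> u)) = \<one>\<^bsub>?P\<^esub>"
        using rel[OF that(3)] that(1,2) by (simp add: pow[OF F.is_group])
      then have "conj_by ?P (\<pi> u \<otimes>\<^bsub>?P\<^esub> \<pi> u) (\<pi> t) \<otimes>\<^bsub>?P\<^esub> (\<pi> u \<otimes>\<^bsub>?P\<^esub> \<pi> u) = \<one>\<^bsub>?P\<^esub>"
        using that(1,2) by (simp add: \<pi>.hom_conj_by)
      then show ?thesis
        using that(1,2) by (intro \<pi>.H.inv_equality[symmetric]) simp_all
    qed
    show "conj_by ?P (x \<otimes>\<^bsub>?P\<^esub> x) y = inv\<^bsub>?P\<^esub> (x \<otimes>\<^bsub>?P\<^esub> x)"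
      "conj_by ?P (y \<otimes>\<^bsub>?P\<^esub> y) x = inv\<^bsub>?P\<^esub> (y \<otimes>\<^bsub>?P\<^esub> y)"
      unfolding x_def y_def by (rule *; simp add: free_gen_in_carrier P_relators_def)+
  qed
  note lattice = \<pi>.H.promislow_lattice[OF xy ab]
  let ?z = "x \<otimes>\<^bsub>?P\<^esub> y \<otimes>\<^bsub>?P\<^esub> (x \<otimes>\<^bsub>?P\<^esub> y)"
  define S where "S = {x \<otimes>\<^bsub>?P\<^esub> x, y \<otimes>\<^bsub>?P\<^esub> y, ?z}"
  have S: "S \<subseteq> carrier ?P" using xy by (simp add: S_def)
  have Z: "generate ?P S \<lhd> ?P"
  proof (rule \<pi>.H.generate_normalI[OF S _ gen])
    have "conj_by ?P (x \<otimes>\<^bsub>?P\<^esub> x) x = x \<otimes>\<^bsub>?P\<^esub> x" "conj_by ?P (y \<otimes>\<^bsub>?P\<^esub> y) y = y \<otimes>\<^bsub>?P\<^esub> y"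
      using xy by (simp_all add: conj_by_def \<pi>.H.m_assoc[symmetric])
    then show "conj_by ?P s g \<in> {s, inv\<^bsub>?P\<^esub> s}" if "s \<in> S" "g \<in> {x, y}" for s g
      using that ab lattice(1,2) unfolding S_def by (elim insertE emptyE) simp_all
  qed (use xy in simp)
  interpret Z: normal "generate ?P S" ?P by (rule Z)
  have S_mem: "x \<otimes>\<^bsub>?P\<^esub> x \<in> generate ?P S" "y \<otimes>\<^bsub>?P\<^esub> y \<in> generate ?P S" "?z \<in> generate ?P S"
    by (rule generate.incl, simp add: S_def)+
  then have mem: "commutator ?P x y \<in> generate ?P S"
    "x [^]\<^bsub>?P\<^esub> (2 :: nat) \<in> generate ?P S" "y [^]\<^bsub>?P\<^esub> (2 :: nat) \<in> generate ?P S"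
    by (simp_all only: lattice(3) Z.m_closed Z.m_inv_closed \<pi>.H.pow_2 xy)
  \<comment> \<open>With two factors each product is u times its conjugate, and the defining
    relations say that this conjugate is the inverse of u.\<close>
  have norm:
    "foldr (\<otimes>\<^bsub>?P\<^esub>) (map (\<lambda>j. conj_by ?P (x [^]\<^bsub>?P\<^esub> (2 :: nat)) (y [^]\<^bsub>?P\<^esub> j)) [0..<2]) \<one>\<^bsub>?P\<^esub> = \<one>\<^bsub>?P\<^esub>"
    "foldr (\<otimes>\<^bsub>?P\<^esub>) (map (\<lambda>i. conj_by ?P (y [^]\<^bsub>?P\<^esub> (2 :: nat)) (x [^]\<^bsub>?P\<^esub> i)) [0..<2]) \<one>\<^bsub>?P\<^esub> = \<one>\<^bsub>?P\<^esub>"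
    using xy ab by (simp_all add: numeral_2_eq_2)
  let ?A = "integer_mod_group (2 * 2)"
  \<comment> \<open>In an abelian target both defining relators become fourth powers, so any two
    values modulo 4 are allowed.\<close>
  have hom: "\<exists>\<alpha> \<in> hom ?P ?A. \<alpha> x = a \<and> \<alpha> y = b" if ab: "a \<in> carrier ?A" "b \<in> carrier ?A" for a b
  proof -
    interpret A: comm_group ?A by simp
    obtain f where f: "f \<in> hom ?F ?A" "f ?fx = a" "f ?fy = b"
      by (rule free_group_hom_two[OF A.is_group ab])
    interpret f: group_hom ?F ?A f
      using f(1) by (simp add: group_hom_def group_hom_axioms_def F.is_group)
    have *: "f (conj_by ?F (u [^]\<^bsub>?F\<^esub> (2::int)) t \<otimes>\<^bsub>?F\<^esub> inv\<^bsub>?F\<^esub> (u [^]\<^bsub>?F\<^esub> (-2::int))) = \<one>\<^bsub>?A\<^esub>"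
      if "u \<in> carrier ?F" "t \<in> carrier ?F" for u t
    proof -
      have "conj_by ?A (f u \<otimes>\<^bsub>?A\<^esub> f u) (f t) = f u \<otimes>\<^bsub>?A\<^esub> f u"
        by (intro A.conj_by_eq A.m_closed f.hom_closed that)
      then have "f (conj_by ?F (u [^]\<^bsub>?F\<^esub> (2::int)) t \<otimes>\<^bsub>?F\<^esub> inv\<^bsub>?F\<^esub> (u [^]\<^bsub>?F\<^esub> (-2::int)))
          = (f u \<otimes>\<^bsub>?A\<^esub> f u) \<otimes>\<^bsub>?A\<^esub> (f u \<otimes>\<^bsub>?A\<^esub> f u)"
        using that by (simp add: pow[OF F.is_group] f.hom_conj_by
            del: mult_integer_mod_group)
      also have "\<dots> = \<one>\<^bsub>?A\<^esub>"
        by (simp add: mod_simps)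
      finally show ?thesis .
    qed
    have "\<forall>u \<in> ?R. f u = \<one>\<^bsub>?A\<^esub>"
      unfolding P_relators_def
      by (intro ballI; elim insertE emptyE; simp only: * free_gen_in_carrier)
    from F.normal_closure_hom[OF R A.is_group f(1) this] obtain g
      where "g \<in> hom (?F Mod normal_closure ?F ?R) ?A"
        "\<forall>u \<in> carrier ?F. g (normal_closure ?F ?R #>\<^bsub>?F\<^esub> u) = f u"
      by (elim bexE)
    then have "g \<in> hom ?P ?A" "g x = a" "g y = b"
      using f(2,3) by (simp_all add: Promislow_def x_def y_def \<pi>_def free_gen_in_carrier)
    then show ?thesis by blast
  qed
  have one: "1 mod int (2 * 2) \<in> carrier ?A"
    by (simp add: carrier_integer_mod_group)
  obtain \<alpha> where \<alpha>: "\<alpha> \<in> hom ?P ?A" "\<alpha> x = 1 mod int (2 * 2)" "\<alpha> y = 0"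
    using hom[OF one integer_mod_group_0] by blast
  obtain \<beta> where \<beta>: "\<beta> \<in> hom ?P ?A" "\<beta> x = 0" "\<beta> y = 1 mod int (2 * 2)"
    using hom[OF integer_mod_group_0 one] by blast
  have "gen_exp ?P = 2 * 2"
    by (rule \<pi>.H.gen_exp_eq[OF _ _ gen xy Z \<pi>.H.generate_commute[OF S lattice(4)[folded S_def]] mem norm \<alpha> \<beta>])
      simp_all
  then show ?thesis by simp
qed

theorem corollary1p3:
  fixes p n m :: nat
  assumes "Factorial_Ring.prime p" and "n > 0" and "m > 0"
  shows "gen_exp (K (p ^ n) (p ^ m)) = p ^ (n + m)
       \<and> gen_exp Promislow = 4
       \<and> gen_exp (K (p ^ 1) (p ^ 1)) = p ^ 2"
proof -
  have "p > 0" using assms(1) by (rule prime_gt_0_nat)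
  then show ?thesis
    by (simp add: gen_exp_K gen_exp_Promislow power_add power2_eq_square)
qed

end
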